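(* Assume $M<\infty$. Assume also that, for some $p>0$, $c>0$, $$\lim_{x\to M-}\frac{\phi(x)}{(M-x)^{p+1}}=c.$$ Then, as $t\to+\infty$, $$\mu(t)=M-\frac{1}{(\lambda pc)^{\frac1p}}\cdot\frac{1}{t^{\frac1p}}+o\left(\frac{1}{t^{\frac1p}}\right).$$ Moreover, provided $E[X_0^2]<\infty$, the asymptotic behavior of $\mathrm{Var}[S_t]$ as $t\to+\infty$ depends on $p$ as follows. If $p<1$ then $$\mathrm{Var}[S_t]\sim\frac{1}{(\lambda p)^{\frac{p+1}{p}}c^{\frac1p}}\left[(M-\mu_0)+\frac{\mathrm{Var}[X_0]}{\phi(\mu_0)}+\int_{\mu_0}^{M}\frac{\mathrm{Var}[(X-w)_+]}{E[(X-w)_+]^2}\,dw\right]\cdot\frac{1}{t^{\frac{p+1}{p}}}.$$ If $p=1$ then $$\mathrm{Var}[S_t]\sim\frac{2}{3\lambda^2c^2}\cdot\frac{\ln(t)}{t^2}.$$ If $p>1$ then $$\mathrm{Var}[S_t]\sim\frac{2}{p-1}\cdot\frac{1}{p+2}\cdot\frac{1}{(\lambda pc)^{\frac2p}}\cdot\frac{1}{t^{\frac2p}}.$$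
   Context: Data: $\lambda>0$; $F,F_0$ are cumulative distribution functions (CDFs) on $\mathbb{R}$ (offer distribution and residual price distribution); $X\sim F$, $X_0\sim F_0$; $y_+=\max(y,0)$; $\mu_0=E[X_0]$; $M=\sup\{x : F(x)<1\}\in(-\infty,+\infty]$. Standing assumptions: $E[X_+]<\infty$, $E[|X_0|]<\infty$, $0\le\mu_0<M$. The notation $a(t)\sim b(t)$ means that $a(t)/b(t)\to1$ as $t\to\infty$. Define $\phi(x)=\int_x^\infty[1-F(u)]\,du$ and $\Psi(x)=\int_{\mu_0}^x\frac{du}{\phi(u)}$ for $x\in[\mu_0,M)$. The optimal policy is the function $\mu:[0,\infty)\to[\mu_0,M)$, $\mu(t)=\Psi^{-1}(\lambda t)$; equivalently, the solution of $\mu'(t)=\lambda\phi(\mu(t))$, $\mu(0)=\mu_0$. Bidding process with marketing period $t\ge 0$ under the optimal policy: let $D_1,D_2,\dots$ be exponential with rate $\lambda$ (inter-arrival times of offers), $X_1,X_2,\dots$ be distributed according to $F$ (offer values), and $X_0$ be distributed according to $F_0$, all independent. The time remaining to the deadline when the $i$-th offer arrives is $t_i=\max(t_{i-1}-D_i,0)$, with initial value $t$ (that is, $t_i=(t-D_1-\dots-D_i)_+$). An offer $X_i$ with $t_i>0$ is accepted if and only if $X_i\ge\mu(t_i)$; at the first accepted offer $i$ the process ends, with realized sale price $S_t=X_i$. If no offer is accepted before the remaining time reaches $0$, then $S_t=X_0$. *)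

theory Defs
  imports "HOL-Probability.Probability" "HOL-Library.Landau_Symbols"
begin

text \<open>
  A cumulative distribution function on the reals is represented by its law \<open>N\<close>, a
  \<^locale>\<open>real_distribution\<close>; the function itself is \<^term>\<open>cdf N\<close>.
\<close>

definition upper_end :: "real measure \<Rightarrow> ereal" where
  "upper_end N = Sup (ereal ` {x. cdf N x < 1})"

definition phi :: "real measure \<Rightarrow> real \<Rightarrow> real" where
  "phi N x = (LBINT u:{x..}. 1 - cdf N u)"

definition Psi :: "real measure \<Rightarrow> real \<Rightarrow> real \<Rightarrow> real" where
  "Psi N m0 x = (LBINT u:{m0..x}. 1 / phi N u)"

definition opt_policy :: "real \<Rightarrow> real measure \<Rightarrow> real \<Rightarrow> real \<Rightarrow> real" where
  "opt_policy lam N m0 t =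
     the_inv_into {x. m0 \<le> x \<and> ereal x < upper_end N} (Psi N m0) (lam * t)"

text \<open>
  For a realization \<open>d\<close> of the inter-arrival times, \<open>time_left d t i\<close> is the time remaining to
  the deadline when the \<open>i\<close>-th offer arrives. Offers are numbered from 1: \<open>d 0\<close> is never used,
  and \<open>x 0\<close> below is the residual price rather than an offer.
\<close>

primrec time_left :: "(nat \<Rightarrow> real) \<Rightarrow> real \<Rightarrow> nat \<Rightarrow> real" where
  "time_left d t 0 = t"
| "time_left d t (Suc i) = max (time_left d t i - d (Suc i)) 0"

definition accepted ::
  "(real \<Rightarrow> real) \<Rightarrow> real \<Rightarrow> (nat \<Rightarrow> real) \<Rightarrow> (nat \<Rightarrow> real) \<Rightarrow> nat \<Rightarrow> bool" where
  "accepted m t d x i \<longleftrightarrow> 1 \<le> i \<and> 0 < time_left d t i \<and> m (time_left d t i) \<le> x i"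

definition sale_price ::
  "(real \<Rightarrow> real) \<Rightarrow> real \<Rightarrow> (nat \<Rightarrow> real) \<Rightarrow> (nat \<Rightarrow> real) \<Rightarrow> real" where
  "sale_price m t d x =
     (if \<exists>i. accepted m t d x i then x (LEAST i. accepted m t d x i) else x 0)"

text \<open>
  Joint independence of \<open>D 1, D 2, \<dots>, X 0, X 1, X 2, \<dots>\<close> is that of a single family indexed by
  the disjoint sum \<^term>\<open>{1::nat..} <+> (UNIV::nat set)\<close>.
\<close>

locale bidding_process = prob_space P for P :: "'a measure" +
  fixes lam :: real and N N0 :: "real measure" and D X :: "nat \<Rightarrow> 'a \<Rightarrow> real"
  assumes interarrival: "\<And>i. 1 \<le> i \<Longrightarrow> distributed P lborel (D i) (exponential_density lam)"
    and offer: "\<And>i. 1 \<le> i \<Longrightarrow> distr P borel (X i) = N"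
    and residual: "distr P borel (X 0) = N0"
    and indep: "indep_vars (\<lambda>_. borel) (case_sum D X) ({1..} <+> UNIV)"

end

theory Submission
  imports Defs
begin

text \<open>
  Write \<open>\<mu>\<close> for the policy, \<open>e x = E[(X - x)\<^sub>+]\<close> and \<open>s x = E[(X - x)\<^sub>+\<^sup>2]\<close> for the first two moments of the
  excess of an offer over \<open>x\<close>. Then \<open>\<phi> = e\<close>, \<open>e' = - P(X > x)\<close>, \<open>s' = - 2 e\<close> and \<open>\<mu>' = \<lambda> e(\<mu>)\<close>.

  Conditioning on the first arrival shows that \<open>h t = E[G(S\<^sub>t)]\<close> ought to satisfy the linear equation
  \<open>h' = \<lambda> E[(G(X) - h) 1{X \<ge> \<mu>}]\<close> with \<open>h 0 = E[G(X\<^sub>0)]\<close>. Conversely every bounded solution of it is the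
  expectation (\<open>expectation_payoff\<close>): run the process for at most \<open>n\<close> offers and then pay \<open>h\<close> of the
  remaining time; the equation makes the expected payoff independent of \<open>n\<close>, and almost surely the
  deadline is reached after finitely many offers. The solution for \<open>G = id\<close> is \<open>\<mu>\<close> itself, so that
  \<open>E[S\<^sub>t] = \<mu>(t)\<close>. For \<open>G x = (x - b)\<^sup>2\<close> it is \<open>v + (\<mu> - b)\<^sup>2\<close>, where \<open>v' = \<lambda> (s(\<mu>) - P(X \<ge> \<mu>) v)\<close> and
  \<open>v 0 = Var[X\<^sub>0]\<close>; the choice \<open>b = \<mu>(t)\<close> shows that \<open>v\<close> is the variance. As \<open>e(\<mu>)\<close> solves the homogeneous
  equation for \<open>v\<close>,

  \<open>Var[S\<^sub>t] = e(\<mu>(t)) (Var[X\<^sub>0] / e(\<mu>\<^sub>0) + \<integral> s / e\<^sup>2)\<close>, the integral being over \<open>[\<mu>\<^sub>0, \<mu>(t)]\<close>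

  (\<open>variance_sale_price\<close>). The distribution function may jump, so the equations for \<open>e\<close> and \<open>v\<close> hold only
  off a countable set of times; the fundamental theorem of calculus is therefore proved with countably
  many exceptions.

  The tail hypothesis is \<open>e x \<sim> c (M - x) powr (p + 1)\<close>. It gives \<open>(M - \<mu>(t)) powr - p \<sim> \<lambda> p c t\<close> by
  l'Hospital's rule, which is the expansion of \<open>\<mu>\<close>. It also gives \<open>s / e\<^sup>2 \<sim> 2 / (c (p + 2)) (M - x) powr - p\<close>,
  and the three regimes are the three behaviours of the integral of this function near \<open>M\<close>: convergent
  for \<open>p < 1\<close>, logarithmic for \<open>p = 1\<close>, a power of \<open>M - x\<close> for \<open>p > 1\<close>. Since
  \<open>s / e\<^sup>2 = 1 + Var[(X - x)\<^sub>+] / E[(X - x)\<^sub>+]\<^sup>2\<close>, for \<open>p < 1\<close> the factor in parentheses above tends to the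
  bracket of the statement.
\<close>

section \<open>Calculus with countably many exceptional points\<close>

text \<open>
  If \<open>f b < f a\<close>, some level \<open>y\<close> strictly between them avoids the countable set \<open>f ` C\<close>. At the last point \<open>s\<close>
  with \<open>f s \<ge> y\<close> the function takes the value \<open>y\<close>, so \<open>s\<close> is not exceptional and \<open>f\<close> increases to the right
  of it, contrary to the choice of \<open>s\<close>.
\<close>

lemma continuous_increasing_except_countable_strict:
  fixes f :: "real \<Rightarrow> real"
  assumes ab: "a \<le> b" and cont: "continuous_on {a..b} f" and C: "countable C"
    and deriv: "\<And>x. a < x \<Longrightarrow> x < b \<Longrightarrow> x \<notin> C \<Longrightarrow> \<exists>D>0. (f has_real_derivative D) (at x)"
  shows "f a \<le> f b"
proof (rule ccontr)
  assume "\<not> f a \<le> f b"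
  then have less: "f b < f a" by simp
  have "uncountable ({f b<..<f a} - f ` C)"
    using uncountable_minus_countable[OF _ countable_image[OF C]] uncountable_open_interval less by blast
  then obtain y where y: "f b < y" "y < f a" "y \<notin> f ` C"
    by (metis DiffE countable_empty equals0I greaterThanLessThan_iff)
  define S where "S = {a..b} \<inter> f -` {y..}"
  have "compact S"
    unfolding S_def compact_eq_bounded_closed
    using continuous_closed_preimage[OF cont closed_atLeastAtMost closed_atLeast] bounded_closed_interval
    by (auto intro: bounded_Int)
  moreover have "a \<in> S" using y ab by (auto simp: S_def)
  ultimately obtain s where s: "s \<in> S" and s_max: "\<And>x. x \<in> S \<Longrightarrow> x \<le> s"
    using compact_attains_sup[of S] by blast
  have above: "f x < y" if "s < x" "x \<le> b" for x
    using s_max[of x] that s by (force simp: S_def)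
  have sb: "s < b" "a \<le> s" "y \<le> f s" using s y by (auto simp: S_def order.strict_iff_order)
  have "\<exists>x\<ge>s. x \<le> b \<and> f x = y"
    using IVT2'[of f b y s] sb y continuous_on_subset[OF cont] by auto
  then have fs: "f s = y" using above sb by (metis less_le_not_le order_le_less)
  then have "a < s" "s \<notin> C" using y sb by (auto simp: order.strict_iff_order)
  then obtain D where "D > 0" "(f has_real_derivative D) (at s)" using deriv sb by blast
  then obtain d where d: "d > 0" "\<And>h. h > 0 \<Longrightarrow> h < d \<Longrightarrow> f s < f (s + h)"
    using DERIV_pos_inc_right by metis
  define h where "h = min (d / 2) (b - s)"
  have "h > 0" "h < d" "s + h \<le> b" using d(1) sb by (auto simp: h_def min_def field_simps)
  then show False using d(2)[of h] above[of "s + h"] fs by auto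
qed

lemma continuous_increasing_except_countable:
  fixes f :: "real \<Rightarrow> real"
  assumes ab: "a \<le> b" and cont: "continuous_on {a..b} f" and C: "countable C"
    and deriv: "\<And>x. a < x \<Longrightarrow> x < b \<Longrightarrow> x \<notin> C \<Longrightarrow> \<exists>D\<ge>0. (f has_real_derivative D) (at x)"
  shows "f a \<le> f b"
proof (rule field_le_epsilon)
  fix e :: real assume e: "e > 0"
  \<comment> \<open>Adding the small slope \<open>r\<close> to \<open>f\<close> makes its derivatives positive and costs at most \<open>e\<close>.\<close>
  define r where "r = e / (b - a + 1)"
  have r: "r > 0" using e ab by (auto simp: r_def)
  have "f a + r * a \<le> f b + r * b"
  proof (rule continuous_increasing_except_countable_strict[OF ab _ C, where f="\<lambda>x. f x + r * x"])
    show "continuous_on {a..b} (\<lambda>x. f x + r * x)" by (intro continuous_intros cont)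
    fix x assume "a < x" "x < b" "x \<notin> C"
    from deriv[OF this] obtain D where "D \<ge> 0" "(f has_real_derivative D) (at x)" by blast
    then show "\<exists>D>0. ((\<lambda>x. f x + r * x) has_real_derivative D) (at x)"
      using r by (intro exI[of _ "D + r"]) (auto intro!: derivative_eq_intros)
  qed
  moreover have "r * (b - a) \<le> e" using e ab by (auto simp: r_def field_simps)
  ultimately show "f a \<le> f b + e" by (simp add: algebra_simps)
qed

text \<open>
  The difference of \<open>f\<close> and the indefinite integral of \<open>k\<close> has derivative \<open>0\<close> off \<open>C\<close>, hence is both
  increasing and decreasing.
\<close>

lemma integral_eq_diff_except_countable:
  fixes f k :: "real \<Rightarrow> real"
  assumes ab: "a \<le> b" and cont: "continuous_on {a..b} f" and C: "countable C"
    and k: "k integrable_on {a..b}"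
    and deriv: "\<And>x. a < x \<Longrightarrow> x < b \<Longrightarrow> x \<notin> C \<Longrightarrow> isCont k x \<and> (f has_real_derivative k x) (at x)"
  shows "integral {a..b} k = f b - f a"
proof -
  define G where "G = (\<lambda>x. f x - integral {a..x} k)"
  have contG: "continuous_on {a..b} G"
    unfolding G_def by (intro continuous_intros cont indefinite_integral_continuous_1 k)
  have dG: "(G has_real_derivative 0) (at x)" if x: "a < x" "x < b" "x \<notin> C" for x
  proof -
    have "((\<lambda>x. integral {a..x} k) has_vector_derivative k x) (at x within {a..b})"
      using integral_has_vector_derivative_continuous_at[OF k, of x "{}"] x deriv[OF x]
      by (simp add: continuous_at_imp_continuous_at_within)
    then have "((\<lambda>x. integral {a..x} k) has_real_derivative k x) (at x)"
      using x by (simp add: has_real_derivative_iff_has_vector_derivative at_within_Icc_at)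
    with deriv[OF x] show ?thesis
      unfolding G_def by (auto intro!: derivative_eq_intros)
  qed
  have "G a \<le> G b"
    by (rule continuous_increasing_except_countable[OF ab contG C]) (use dG in blast)
  moreover have "- G a \<le> - G b"
    by (rule continuous_increasing_except_countable[OF ab _ C, where f="\<lambda>x. - G x"])
       (use dG contG in \<open>force intro!: continuous_intros derivative_eq_intros exI[of _ 0]\<close>)+
  ultimately show ?thesis by (auto simp: G_def)
qed

section \<open>The mean and second moment of the excess of an offer\<close>

locale bounded_offers = real_distribution N for N :: "real measure" +
  fixes M :: real
  assumes upper_end_eq: "upper_end N = ereal M"
begin

lemma cdf_upper_end: assumes "M \<le> x" shows "cdf N x = 1"
proof -
  have above: "cdf N y = 1" if "M < y" for y
  proof (rule ccontr)
    assume "cdf N y \<noteq> 1"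
    then have "cdf N y < 1" using cdf_bounded_prob[of y] by simp
    then have "ereal y \<le> upper_end N" unfolding upper_end_def by (intro Sup_upper) auto
    with that show False by (simp add: upper_end_eq)
  qed
  have "(cdf N \<longlongrightarrow> cdf N M) (at_right M)"
    using cdf_is_right_cont by (simp add: continuous_within)
  moreover have "(cdf N \<longlongrightarrow> 1) (at_right M)"
    by (rule tendsto_eventually) (use above in \<open>auto simp: eventually_at_filter\<close>)
  ultimately have "cdf N M = 1" by (rule tendsto_unique[rotated]) simp
  with above assms show ?thesis by (cases "x = M") auto
qed

lemma cdf_less_1: assumes "x < M" shows "cdf N x < 1"
proof -
  have "ereal x < upper_end N" using assms by (simp add: upper_end_eq)
  then obtain y where "x < y" "cdf N y < 1" unfolding upper_end_def less_Sup_iff by auto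
  then show ?thesis using cdf_nondecreasing[of x y] by linarith
qed

lemma AE_le_upper_end: "AE y in N. y \<le> M"
proof -
  have "prob {..M} = 1" using cdf_upper_end[of M] by (simp add: cdf_def)
  then show ?thesis by (subst (asm) prob_eq_1) auto
qed

lemma integrable_excess: "integrable N (\<lambda>y. max (y - x) 0)"
  by (rule integrable_const_bound[where B="\<bar>M - x\<bar>"]) (use AE_le_upper_end in \<open>auto elim!: eventually_mono\<close>)

lemma integrable_excess_sq: "integrable N (\<lambda>y. (max (y - x) 0)\<^sup>2)"
proof (rule integrable_const_bound[where B="\<bar>M - x\<bar>\<^sup>2"])
  show "AE y in N. norm ((max (y - x) 0)\<^sup>2) \<le> \<bar>M - x\<bar>\<^sup>2"
    using AE_le_upper_end
  proof eventually_elim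
    case (elim y)
    then have "(max (y - x) 0)\<^sup>2 \<le> \<bar>M - x\<bar>\<^sup>2" by (intro power_mono) auto
    then show ?case by simp
  qed
qed auto

definition excess :: "real \<Rightarrow> real" where
  "excess x = (\<integral>y. max (y - x) 0 \<partial>N)"

text \<open>
  Together with \<open>excess\<close>, this gives the variance of \<open>(X - x)\<^sub>+\<close>; unlike the variance, it has a simple derivative
  (\<open>excess_sq_has_derivative\<close>).
\<close>

definition excess_sq :: "real \<Rightarrow> real" where
  "excess_sq x = (\<integral>y. (max (y - x) 0)\<^sup>2 \<partial>N)"

lemma integral_indicator_greaterThan: "(\<integral>y. indicator {x<..} y \<partial>N) = 1 - cdf N x"
proof -
  have "{x<..} = space N - {..x}" by auto
  then have "prob {x<..} = 1 - cdf N x" by (simp only:) (subst prob_compl, auto simp: cdf_def)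
  then show ?thesis by simp
qed

text \<open>
  The difference \<open>(y - a)\<^sub>+ - (y - b)\<^sub>+\<close> lies between \<open>b - a\<close> times the indicators of \<open>y > b\<close> and of \<open>y > a\<close>.
  All regularity of \<open>excess\<close> follows from these two bounds.
\<close>

lemma excess_diff_bounds:
  assumes "a \<le> b"
  shows "(b - a) * (1 - cdf N b) \<le> excess a - excess b" "excess a - excess b \<le> (b - a) * (1 - cdf N a)"
proof -
  have int: "integrable N (\<lambda>y. (b - a) * indicator {x<..} y)" for x :: real
    by (rule integrable_const_bound[where B="b - a"]) (use assms in \<open>auto simp: indicator_def\<close>)
  have "excess a - excess b = (\<integral>y. max (y - a) 0 - max (y - b) 0 \<partial>N)"
    unfolding excess_def by (intro Bochner_Integration.integral_diff[symmetric] integrable_excess)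
  moreover have "(\<integral>y. (b - a) * indicator {b<..} y \<partial>N) \<le> (\<integral>y. max (y - a) 0 - max (y - b) 0 \<partial>N)"
    by (intro integral_mono Bochner_Integration.integrable_diff integrable_excess int)
       (use assms in \<open>auto simp: indicator_def max_def\<close>)
  moreover have "(\<integral>y. max (y - a) 0 - max (y - b) 0 \<partial>N) \<le> (\<integral>y. (b - a) * indicator {a<..} y \<partial>N)"
    by (intro integral_mono Bochner_Integration.integrable_diff integrable_excess int)
       (use assms in \<open>auto simp: indicator_def max_def\<close>)
  ultimately show "(b - a) * (1 - cdf N b) \<le> excess a - excess b" 
      "excess a - excess b \<le> (b - a) * (1 - cdf N a)"
    using integral_indicator_greaterThan[of a] integral_indicator_greaterThan[of b] by simp_all
qed

lemma excess_has_derivative: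
  assumes "isCont (cdf N) x"
  shows "(excess has_real_derivative - (1 - cdf N x)) (at x)"
proof -
  have *: "\<bar>(excess y - excess x) / (y - x) + (1 - cdf N x)\<bar> \<le> \<bar>cdf N y - cdf N x\<bar>" if "y \<noteq> x" for y
  proof (cases "x < y")
    case True
    with excess_diff_bounds[of x y] have "1 - cdf N y \<le> - ((excess y - excess x) / (y - x))"
      "- ((excess y - excess x) / (y - x)) \<le> 1 - cdf N x"
      by (auto simp: field_simps)
    with cdf_nondecreasing[of x y] True show ?thesis by linarith
  next
    case False
    with that excess_diff_bounds[of y x] have "- ((excess y - excess x) / (y - x)) \<le> 1 - cdf N y"
      "1 - cdf N x \<le> - ((excess y - excess x) / (y - x))"
      by (auto simp: field_simps)
    with cdf_nondecreasing[of y x] False show ?thesis by linarith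
  qed
  have "((\<lambda>y. \<bar>cdf N y - cdf N x\<bar>) \<longlongrightarrow> 0) (at x)"
    using assms unfolding isCont_def by (intro tendsto_rabs_zero LIM_zero tendsto_ident_at)
  then have "((\<lambda>y. (excess y - excess x) / (y - x) + (1 - cdf N x)) \<longlongrightarrow> 0) (at x)"
    by (rule Lim_null_comparison[rotated]) (use * in \<open>auto simp: eventually_at_filter\<close>)
  then have "((\<lambda>y. (excess y - excess x) / (y - x)) \<longlongrightarrow> - (1 - cdf N x)) (at x)"
    by (subst LIM_zero_iff[symmetric]) (simp add: algebra_simps)
  then show ?thesis by (simp add: has_field_derivative_iff)
qed

lemma excess_lipschitz: "\<bar>excess x - excess y\<bar> \<le> \<bar>x - y\<bar>"
proof -
  have *: "\<bar>excess a - excess b\<bar> \<le> \<bar>a - b\<bar>" if "a \<le> b" for a b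
  proof -
    have "(b - a) * (1 - cdf N a) \<le> (b - a) * 1" "0 \<le> (b - a) * (1 - cdf N b)"
      using that cdf_nonneg cdf_bounded_prob by (intro mult_left_mono mult_nonneg_nonneg; simp)+
    with excess_diff_bounds[OF that] that show ?thesis by simp
  qed
  show ?thesis using *[of x y] *[of y x] by (cases "x \<le> y") (auto simp: abs_minus_commute)
qed

lemma continuous_on_excess: "continuous_on S excess"
proof (rule continuous_on_subset[OF _ subset_UNIV], rule continuous_at_imp_continuous_on, rule ballI)
  fix x :: real
  have "((\<lambda>y. \<bar>y - x\<bar>) \<longlongrightarrow> \<bar>x - x\<bar>) (at x)" by (intro tendsto_intros)
  then have lim: "((\<lambda>y. \<bar>y - x\<bar>) \<longlongrightarrow> 0) (at x)" by simp
  from lim have "((\<lambda>y. excess y - excess x) \<longlongrightarrow> 0) (at x)"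
    by (rule Lim_null_comparison[rotated]) (use excess_lipschitz in \<open>auto simp: eventually_at_filter\<close>)
  then show "isCont excess x" unfolding isCont_def by (simp add: LIM_zero_cancel)
qed

lemma isCont_excess: "isCont excess x"
  using continuous_on_excess[of UNIV] by (simp add: continuous_on_eq_continuous_at)

lemma excess_eq_0: assumes "M \<le> x" shows "excess x = 0"
  unfolding excess_def by (rule integral_eq_zero_AE) (use AE_le_upper_end assms in \<open>auto elim!: eventually_mono\<close>)

lemma excess_pos: assumes "x < M" shows "0 < excess x"
proof -
  define y where "y = (x + M) / 2"
  have y: "x < y" "y < M" using assms by (auto simp: y_def field_simps)
  have "0 < (y - x) * (1 - cdf N y)" using y cdf_less_1[of y] by simp
  also have "\<dots> \<le> excess x - excess y" using excess_diff_bounds(1)[of x y] y by simp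
  also have "\<dots> \<le> excess x" unfolding excess_def by simp
  finally show ?thesis .
qed

lemma excess_le: assumes "x \<le> M" shows "excess x \<le> M - x"
proof -
  have "(M - x) * (1 - cdf N x) \<le> (M - x) * 1"
    using assms cdf_nonneg by (intro mult_left_mono) auto
  then show ?thesis using excess_diff_bounds(2)[OF assms] excess_eq_0[of M] by simp
qed

lemma countable_discontinuities: "countable {x. \<not> isCont (cdf N) x}"
proof -
  have "{x. \<not> isCont (cdf N) x} = {x. prob {x} > 0}" by (auto simp: isCont_cdf zero_less_measure_iff)
  then show ?thesis using countable_atoms by simp
qed

lemma measurable_cdf [measurable]: "cdf N \<in> borel_measurable borel"
  by (rule borel_measurable_mono) (auto simp: mono_def cdf_nondecreasing)

text \<open>
  Both sides vanish beyond \<open>M\<close>, and \<open>- excess\<close> is a primitive of the tail \<open>1 - cdf N\<close> at its points of continuity.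
\<close>

lemma phi_eq_excess: "phi N x = excess x"
proof -
  have tail: "phi N x = (LBINT u:{x..M}. 1 - cdf N u)"
    unfolding phi_def set_lebesgue_integral_def
    by (intro Bochner_Integration.integral_cong) (auto simp: indicator_def cdf_upper_end)
  show ?thesis
  proof (cases "x \<le> M")
    case True
    have int: "set_integrable lborel {x..M} (\<lambda>u. 1 - cdf N u)"
    proof -
      have "integrable lborel (\<lambda>u. indicator {x..M} u * (1 - cdf N u))"
      proof (rule Bochner_Integration.integrable_bound)
        show "integrable lborel (indicator {x..M} :: real \<Rightarrow> real)"
          by (intro integrable_real_indicator) (auto simp: emeasure_lborel_Icc_eq)
      qed (simp_all add: indicator_def cdf_nonneg cdf_bounded_prob)
      then show ?thesis by (simp add: set_integrable_def)
    qed
    have "phi N x = integral {x..M} (\<lambda>u. 1 - cdf N u)"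
      unfolding tail by (rule set_borel_integral_eq_integral(2)[OF int])
    also have "\<dots> = - excess M - - excess x"
    proof (rule integral_eq_diff_except_countable[OF True _ countable_discontinuities])
      show "continuous_on {x..M} (\<lambda>x. - excess x)" by (intro continuous_intros continuous_on_excess)
      show "(\<lambda>u. 1 - cdf N u) integrable_on {x..M}" by (rule set_borel_integral_eq_integral(1)[OF int])
    qed (auto intro!: continuous_intros derivative_eq_intros excess_has_derivative)
    finally show ?thesis by (simp add: excess_eq_0)
  next
    case False
    then have "{x..M} = {}" by auto
    with False show ?thesis by (simp add: tail excess_eq_0 set_lebesgue_integral_def)
  qed
qed

text \<open>
  The first-order Taylor error of \<open>x \<mapsto> ((z - x)\<^sub>+)\<^sup>2\<close> is at most the squared increment, uniformly in \<open>z\<close>,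
  so that it survives integration over the offer \<open>z\<close>.
\<close>

lemma excess_sq_has_derivative: "(excess_sq has_real_derivative - 2 * excess x) (at x)"
proof -
  have pointwise: "\<bar>(max (z - y) 0)\<^sup>2 - (max (z - x) 0)\<^sup>2 + 2 * (y - x) * max (z - x) 0\<bar> \<le> (y - x)\<^sup>2" for y z :: real
  proof -
    consider "z \<le> x" "z \<le> y" | "z \<le> x" "y < z" | "x < z" "z \<le> y" | "x < z" "y < z" by linarith
    then show ?thesis
    proof cases
      case 1 then show ?thesis by (simp add: max_def)
    next
      case 2
      then have "(z - y)\<^sup>2 \<le> (x - y)\<^sup>2" by (intro power_mono) auto
      with 2 show ?thesis by (auto simp: max_def power2_commute)
    next
      case 3
      have "- ((z - x)\<^sup>2) + 2 * (y - x) * (z - x) = (y - x)\<^sup>2 - (y - z)\<^sup>2" by algebra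
      moreover have "0 \<le> (y - z)\<^sup>2" "(y - z)\<^sup>2 \<le> (y - x)\<^sup>2" using 3 by (auto intro!: power_mono)
      ultimately show ?thesis using 3 by (auto simp: max_def)
    next
      case 4
      have "(z - y)\<^sup>2 - (z - x)\<^sup>2 + 2 * (y - x) * (z - x) = (y - x)\<^sup>2" by algebra
      with 4 show ?thesis by (simp add: max_def)
    qed
  qed
  have bound: "\<bar>excess_sq y - excess_sq x + 2 * (y - x) * excess x\<bar> \<le> (y - x)\<^sup>2" for y
  proof -
    have int: "integrable N (\<lambda>z. (max (z - y) 0)\<^sup>2 - (max (z - x) 0)\<^sup>2 + 2 * (y - x) * max (z - x) 0)"
      by (intro Bochner_Integration.integrable_add Bochner_Integration.integrable_diff
          integrable_excess_sq integrable_mult_right integrable_excess)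
    have "excess_sq y - excess_sq x + 2 * (y - x) * excess x =
        (\<integral>z. (max (z - y) 0)\<^sup>2 - (max (z - x) 0)\<^sup>2 + 2 * (y - x) * max (z - x) 0 \<partial>N)"
      by (simp add: excess_sq_def excess_def integrable_excess integrable_excess_sq)
    also have "\<bar>\<dots>\<bar> \<le> (\<integral>z. (y - x)\<^sup>2 \<partial>N)"
      by (rule order_trans[OF integral_abs_bound integral_mono[OF integrable_abs[OF int] _ pointwise]]) simp
    also have "\<dots> = (y - x)\<^sup>2" using prob_space by simp
    finally show ?thesis .
  qed
  have *: "\<bar>(excess_sq y - excess_sq x) / (y - x) + 2 * excess x\<bar> \<le> \<bar>y - x\<bar>" if "y \<noteq> x" for y
  proof -
    have "(excess_sq y - excess_sq x) / (y - x) + 2 * excess x = (excess_sq y - excess_sq x + 2 * (y - x) * excess x) / (y - x)"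
      using that by (simp add: field_simps)
    also have "\<bar>\<dots>\<bar> \<le> (y - x)\<^sup>2 / \<bar>y - x\<bar>"
      unfolding abs_divide by (intro divide_right_mono bound) simp
    also have "\<dots> = \<bar>y - x\<bar>"
      using that by (subst power2_abs[symmetric]) (simp add: power2_eq_square del: abs_mult_self_eq)
    finally show ?thesis .
  qed
  have "((\<lambda>y. \<bar>y - x\<bar>) \<longlongrightarrow> \<bar>x - x\<bar>) (at x)" by (intro tendsto_intros)
  then have lim: "((\<lambda>y. \<bar>y - x\<bar>) \<longlongrightarrow> 0) (at x)" by simp
  from lim have "((\<lambda>y. (excess_sq y - excess_sq x) / (y - x) + 2 * excess x) \<longlongrightarrow> 0) (at x)"
    by (rule Lim_null_comparison[rotated]) (use * in \<open>auto simp: eventually_at_filter\<close>)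
  then have "((\<lambda>y. (excess_sq y - excess_sq x) / (y - x)) \<longlongrightarrow> - 2 * excess x) (at x)"
    by (subst LIM_zero_iff[symmetric]) (simp add: algebra_simps)
  then show ?thesis by (simp add: has_field_derivative_iff)
qed

lemma isCont_excess_sq: "isCont excess_sq x"
  using excess_sq_has_derivative by (rule DERIV_isCont)

lemma excess_sq_upper_end: "excess_sq M = 0"
  unfolding excess_sq_def by (rule integral_eq_zero_AE) (use AE_le_upper_end in \<open>auto elim!: eventually_mono\<close>)

lemma excess_sq_nonneg: "0 \<le> excess_sq x"
  unfolding excess_sq_def by simp

lemma variance_excess: "variance (\<lambda>y. max (y - x) 0) = excess_sq x - (excess x)\<^sup>2"
  by (subst variance_eq) (simp_all add: integrable_excess integrable_excess_sq excess_sq_def excess_def)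

text \<open>
  An offer equal to the threshold is accepted, so the acceptance probability is \<open>P(X \<ge> x)\<close>, whereas the derivative
  of \<open>excess\<close> involves \<open>P(X > x)\<close>. They agree, with continuity, where the law has no atom.
\<close>

lemma isCont_prob_atLeast:
  assumes "isCont (cdf N) x"
  shows "isCont (\<lambda>y. prob {y..}) x" "prob {x..} = 1 - cdf N x"
proof -
  have compl: "prob {y..} = 1 - prob {..<y}" for y
  proof -
    have "{y..} = space N - {..<y}" by auto
    then show ?thesis by (simp only: ) (subst prob_compl, auto)
  qed
  have "cdf N x = prob {..<x} + prob {x}"
  proof -
    have "{..x} = {..<x} \<union> {x}" by auto
    then show ?thesis unfolding cdf_def by (simp only: ) (subst finite_measure_Union, auto)
  qed
  then have at_x: "prob {..<x} = cdf N x" using assms by (simp add: isCont_cdf)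
  with compl show "prob {x..} = 1 - cdf N x" by simp
  have lim: "(cdf N \<longlongrightarrow> cdf N x) (at x)" using assms by (simp add: isCont_def)
  have "((\<lambda>y. prob {..<y}) \<longlongrightarrow> cdf N x) (at x)"
  proof (rule tendsto_sandwich)
    have "isCont (\<lambda>y. cdf N (y - \<bar>y - x\<bar>)) x"
      by (rule isCont_o2[where g="cdf N"]) (use assms in \<open>auto intro!: continuous_intros\<close>)
    then show "((\<lambda>y. cdf N (y - \<bar>y - x\<bar>)) \<longlongrightarrow> cdf N x) (at x)" by (simp add: isCont_def)
    show "\<forall>\<^sub>F y in at x. cdf N (y - \<bar>y - x\<bar>) \<le> prob {..<y}"
      unfolding cdf_def by (auto simp: eventually_at_filter intro!: always_eventually finite_measure_mono)
    show "\<forall>\<^sub>F y in at x. prob {..<y} \<le> cdf N y"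
      unfolding cdf_def by (auto intro!: always_eventually finite_measure_mono)
  qed (rule lim)
  then show "isCont (\<lambda>y. prob {y..}) x"
    unfolding compl isCont_def at_x by (intro tendsto_intros)
qed

end

section \<open>The optimal policy\<close>

text \<open>
  This and the next lemma treat a primitive on a half-open interval, since the integrands \<open>1 / excess\<close> and
  \<open>excess_sq / (excess)\<^sup>2\<close> of interest may blow up at the right end \<open>M\<close>.
\<close>

lemma integral_has_real_derivative_Ico:
  fixes k :: "real \<Rightarrow> real"
  assumes k: "continuous_on {a..<b} k" and x: "a < x" "x < b"
  shows "((\<lambda>x. integral {a..x} k) has_real_derivative k x) (at x)"
proof -
  define y where "y = (x + b) / 2"
  have y: "x < y" "y < b" using x by (auto simp: y_def field_simps)
  have cont: "continuous_on {a..y} k" using y by (intro continuous_on_subset[OF k]) auto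
  have "((\<lambda>x. integral {a..x} k) has_real_derivative k x) (at x within {a..y})"
    by (rule integral_has_real_derivative[OF cont]) (use x y in auto)
  then show ?thesis using x y by (simp add: at_within_Icc_at)
qed

lemma continuous_on_integral_Ico:
  fixes k :: "real \<Rightarrow> real"
  assumes k: "continuous_on {a..<b} k"
  shows "continuous_on {a..<b} (\<lambda>x. integral {a..x} k)"
proof (rule continuous_on_eq_continuous_within[THEN iffD2, rule_format])
  fix x assume x: "x \<in> {a..<b}"
  define y where "y = (x + b) / 2"
  have y: "x < y" "y < b" using x by (auto simp: y_def field_simps)
  have cont: "continuous_on {a..y} k" using y by (intro continuous_on_subset[OF k]) auto
  have "continuous_on {a..y} (\<lambda>x. integral {a..x} k)"
    by (intro indefinite_integral_continuous_1 integrable_continuous_real cont)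
  then have "continuous (at x within {a..y}) (\<lambda>x. integral {a..x} k)"
    using x y by (auto simp: continuous_on_eq_continuous_within)
  moreover have "at x within {a..y} = at x within {a..<b}"
    using x y by (intro at_within_nhd[where S="{..<y}"]) auto
  ultimately show "continuous (at x within {a..<b}) (\<lambda>x. integral {a..x} k)" by simp
qed

lemma increasing_on_Ico:
  fixes f :: "real \<Rightarrow> real"
  assumes cont: "continuous_on {a..<b} f"
    and deriv: "\<And>x. a < x \<Longrightarrow> x < b \<Longrightarrow> (f has_real_derivative f' x) (at x)"
    and nonneg: "\<And>x. a < x \<Longrightarrow> x < b \<Longrightarrow> 0 \<le> f' x"
    and xy: "a \<le> x" "x \<le> y" "y < b"
  shows "f x \<le> f y"
proof (rule continuous_increasing_except_countable[where C="{}", OF \<open>x \<le> y\<close>])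
  show "continuous_on {x..y} f" using xy by (intro continuous_on_subset[OF cont]) auto
  show "\<exists>D\<ge>0. (f has_real_derivative D) (at z)" if "x < z" "z < y" for z
    using that xy by (intro exI[of _ "f' z"] conjI deriv nonneg) auto
qed simp

locale selling = bounded_offers N M for N :: "real measure" and M :: real +
  fixes lam m0 :: real
  assumes lam_pos: "0 < lam" and m0_less: "m0 < M"
begin

definition mu :: "real \<Rightarrow> real" where "mu = opt_policy lam N m0"

lemma continuous_on_inverse_excess: "continuous_on {m0..<M} (\<lambda>u. 1 / excess u)"
  by (intro continuous_intros continuous_on_excess) (use excess_pos in \<open>force dest: less_imp_neq\<close>)

lemma Psi_eq_integral: assumes "x < M" shows "Psi N m0 x = integral {m0..x} (\<lambda>u. 1 / excess u)"
proof -
  have "continuous_on {m0..x} (\<lambda>u. 1 / excess u)"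
    using assms by (intro continuous_on_subset[OF continuous_on_inverse_excess]) auto
  then have "set_integrable lborel {m0..x} (\<lambda>u. 1 / excess u)" by (rule borel_integrable_atLeastAtMost')
  then show ?thesis unfolding Psi_def phi_eq_excess by (rule set_borel_integral_eq_integral(2))
qed

lemma Psi_has_derivative:
  assumes "m0 < x" "x < M" shows "(Psi N m0 has_real_derivative 1 / excess x) (at x)"
  using integral_has_real_derivative_Ico[OF continuous_on_inverse_excess assms]
proof (rule has_field_derivative_transform_within_open)
  show "open {..<M}" "x \<in> {..<M}" using assms by auto
qed (simp add: Psi_eq_integral)

lemma continuous_on_Psi: "continuous_on {m0..<M} (Psi N m0)"
  using continuous_on_integral_Ico[OF continuous_on_inverse_excess]
  by (rule continuous_on_eq) (simp add: Psi_eq_integral)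

lemma Psi_m0: "Psi N m0 m0 = 0"
  using m0_less by (simp add: Psi_eq_integral)

text \<open>
  Since \<open>excess\<close> is at most \<open>M - m0\<close> on the interval, \<open>Psi\<close> expands distances by a fixed factor. This yields
  its injectivity and the Lipschitz continuity of its inverse.
\<close>

lemma Psi_expanding:
  assumes "m0 \<le> x" "x \<le> y" "y < M"
  shows "(y - x) / (M - m0) \<le> Psi N m0 y - Psi N m0 x"
proof -
  have "Psi N m0 x - x / (M - m0) \<le> Psi N m0 y - y / (M - m0)"
  proof (rule increasing_on_Ico[OF _ _ _ assms])
    show "continuous_on {m0..<M} (\<lambda>x. Psi N m0 x - x / (M - m0))"
      using m0_less by (intro continuous_intros continuous_on_Psi) auto
    fix x assume x: "m0 < x" "x < M"
    show "((\<lambda>x. Psi N m0 x - x / (M - m0)) has_real_derivative (1 / excess x - 1 / (M - m0))) (at x)"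
      using m0_less by (auto intro!: derivative_eq_intros Psi_has_derivative x)
    have "excess x \<le> M - m0" using excess_le[of x] x by simp
    then show "0 \<le> 1 / excess x - 1 / (M - m0)" using excess_pos[of x] x by (simp add: frac_le)
  qed
  then show ?thesis by (simp add: diff_divide_distrib)
qed

text \<open>
  The bound \<open>excess u \<le> M - u\<close> makes \<open>Psi\<close> diverge at \<open>M\<close>, so that the policy is defined for all times.
\<close>

lemma Psi_ge_ln: assumes "m0 \<le> x" "x < M" shows "ln ((M - m0) / (M - x)) \<le> Psi N m0 x"
proof -
  have "Psi N m0 m0 + ln (M - m0) \<le> Psi N m0 x + ln (M - x)"
  proof (rule increasing_on_Ico[OF _ _ _ order.refl assms])
    show "continuous_on {m0..<M} (\<lambda>x. Psi N m0 x + ln (M - x))"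
      by (intro continuous_intros continuous_on_Psi) auto
    fix x assume x: "m0 < x" "x < M"
    show "((\<lambda>x. Psi N m0 x + ln (M - x)) has_real_derivative (1 / excess x - 1 / (M - x))) (at x)"
      using x by (auto intro!: derivative_eq_intros Psi_has_derivative)
    have "excess x \<le> M - x" using excess_le[of x] x by simp
    then show "0 \<le> 1 / excess x - 1 / (M - x)" using excess_pos[of x] x by (simp add: frac_le)
  qed
  then show ?thesis using assms m0_less by (simp add: Psi_m0 ln_div)
qed

lemma inj_on_Psi: "inj_on (Psi N m0) {m0..<M}"
proof (rule linorder_inj_onI')
  fix x y assume xy: "x \<in> {m0..<M}" "y \<in> {m0..<M}" "x < y"
  then have "0 < (y - x) / (M - m0)" using m0_less by simp
  with Psi_expanding[of x y] xy show "Psi N m0 x \<noteq> Psi N m0 y" by fastforce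
qed

lemma Psi_attains: assumes "0 \<le> s" shows "s \<in> Psi N m0 ` {m0..<M}"
proof -
  \<comment> \<open>The point at which the logarithmic lower bound of \<open>Psi\<close> equals \<open>s\<close>.\<close>
  define b where "b = M - (M - m0) * exp (- s)"
  have b: "m0 \<le> b" "b < M"
  proof -
    have "(M - m0) * exp (- s) \<le> (M - m0) * 1" using assms m0_less by (intro mult_left_mono) auto
    then show "m0 \<le> b" by (simp add: b_def)
    show "b < M" using m0_less by (simp add: b_def)
  qed
  have "(M - m0) / (M - b) = exp s" using m0_less by (simp add: b_def exp_minus field_simps)
  then have "s \<le> Psi N m0 b" using Psi_ge_ln[OF b] by simp
  then have "\<exists>x\<ge>m0. x \<le> b \<and> Psi N m0 x = s"
    using b assms by (intro IVT' continuous_on_subset[OF continuous_on_Psi]) (auto simp: Psi_m0)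
  then show ?thesis using b by (auto simp: image_iff)
qed

lemma mu_eq: "mu t = the_inv_into {m0..<M} (Psi N m0) (lam * t)"
proof -
  have "{x. m0 \<le> x \<and> ereal x < upper_end N} = {m0..<M}" by (auto simp: upper_end_eq)
  then show ?thesis by (simp add: mu_def opt_policy_def)
qed

lemma
  assumes "0 \<le> t"
  shows mu_ge: "m0 \<le> mu t" and mu_less: "mu t < M" and Psi_mu: "Psi N m0 (mu t) = lam * t"
proof -
  have s: "lam * t \<in> Psi N m0 ` {m0..<M}" using assms lam_pos by (intro Psi_attains) simp
  have "mu t \<in> {m0..<M}" unfolding mu_eq by (rule the_inv_into_into[OF inj_on_Psi s order.refl])
  then show "m0 \<le> mu t" "mu t < M" by auto
  show "Psi N m0 (mu t) = lam * t" unfolding mu_eq by (rule f_the_inv_into_f[OF inj_on_Psi s])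
qed

lemma mu_0: "mu 0 = m0"
proof -
  have "the_inv_into {m0..<M} (Psi N m0) (Psi N m0 m0) = m0"
    using m0_less by (intro the_inv_into_f_f inj_on_Psi) auto
  then show ?thesis by (simp add: mu_eq Psi_m0)
qed

lemma mu_lipschitz: assumes "0 \<le> s" "0 \<le> t" shows "\<bar>mu s - mu t\<bar> \<le> (M - m0) * lam * \<bar>s - t\<bar>"
proof -
  have *: "\<bar>mu s - mu t\<bar> \<le> (M - m0) * lam * \<bar>s - t\<bar>" if "0 \<le> s" "0 \<le> t" "mu s \<le> mu t" for s t
  proof -
    have "(mu t - mu s) / (M - m0) \<le> lam * (t - s)"
      using Psi_expanding[of "mu s" "mu t"] that mu_ge mu_less Psi_mu by (simp add: right_diff_distrib)
    also have "\<dots> \<le> lam * \<bar>s - t\<bar>" using lam_pos by (intro mult_left_mono) auto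
    finally show ?thesis using that m0_less by (simp add: field_simps)
  qed
  show ?thesis using *[of s t] *[of t s] assms by (cases "mu s \<le> mu t") (auto simp: abs_minus_commute)
qed

lemma continuous_on_mu: "continuous_on {0..} mu"
proof (rule lipschitz_on_continuous_on)
  show "((M - m0) * lam)-lipschitz_on {0..} mu"
    by (rule lipschitz_onI) (use mu_lipschitz m0_less lam_pos in \<open>auto simp: dist_real_def\<close>)
qed

lemma isCont_mu: assumes "0 < t" shows "isCont mu t"
  using continuous_on_mu assms by (intro continuous_on_interior[where S="{0..}"]) (auto simp: interior_real_atLeast)

lemma inj_on_mu: "inj_on mu {0..}"
  by (rule inj_on_inverseI[where g="\<lambda>x. Psi N m0 x / lam"]) (use Psi_mu lam_pos in auto)

lemma mu_gt: assumes "0 < t" shows "m0 < mu t"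
proof -
  have "mu t \<noteq> m0" using inj_onD[OF inj_on_mu, of t 0] assms mu_0 by auto
  with mu_ge[of t] assms show ?thesis by simp
qed

lemma mu_has_derivative:
  assumes "0 < t" shows "(mu has_real_derivative lam * excess (mu t)) (at t)"
proof -
  have mu: "m0 < mu t" "mu t < M" using mu_gt mu_less assms by auto
  have "(mu has_real_derivative inverse (1 / excess (mu t) / lam)) (at t)"
  proof (rule DERIV_inverse_function[where f="\<lambda>x. Psi N m0 x / lam" and a=0 and b="t + 1"])
    show "((\<lambda>x. Psi N m0 x / lam) has_real_derivative 1 / excess (mu t) / lam) (at (mu t))"
      using lam_pos by (intro DERIV_cdivide Psi_has_derivative mu)
    show "1 / excess (mu t) / lam \<noteq> 0" using excess_pos[of "mu t"] mu lam_pos by simp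
  qed (use assms isCont_mu Psi_mu lam_pos in auto)
  then show ?thesis by (simp add: field_simps)
qed

lemma mu_at_top: "filterlim mu (at_left M) at_top"
proof -
  have "eventually (\<lambda>t. y < mu t) at_top" if "y < M" for y
  proof -
    define z where "z = max y m0"
    have z: "m0 \<le> z" "z < M" "y \<le> z" using that m0_less by (auto simp: z_def)
    have "z < mu t" if t: "max 0 (Psi N m0 z / lam) < t" for t
    proof (rule ccontr)
      assume "\<not> z < mu t"
      then have "0 \<le> (z - mu t) / (M - m0)" using m0_less by simp
      also have "\<dots> \<le> Psi N m0 z - Psi N m0 (mu t)"
        using Psi_expanding[of "mu t" z] \<open>\<not> z < mu t\<close> z t mu_ge[of t] by simp
      finally have "0 \<le> Psi N m0 z - Psi N m0 (mu t)" .
      then show False using t Psi_mu[of t] lam_pos by (simp add: field_simps)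
    qed
    then show ?thesis using z eventually_gt_at_top[of "max 0 (Psi N m0 z / lam)"]
      by (auto elim!: eventually_mono intro: le_less_trans)
  qed
  moreover have "eventually (\<lambda>t. mu t < a) at_top" if "M < a" for a
    using eventually_ge_at_top[of "0::real"] by eventually_elim (use that mu_less in \<open>auto intro: less_trans\<close>)
  ultimately have "(mu \<longlongrightarrow> M) at_top" by (intro order_tendstoI)
  then show ?thesis
    unfolding filterlim_at using eventually_mono[OF eventually_ge_at_top[of "0::real"]] mu_less
    by (metis (mono_tags, lifting) UNIV_I lessThan_iff less_irrefl)
qed

end

section \<open>The terminal payoff of the bidding process\<close>

context prob_space begin

text \<open>
  Fubini's theorem for independent variables, stated on the underlying space so that no law has to be named.
\<close>

lemma indep_var_expectation_iterated:
  fixes f :: "_ \<Rightarrow> real"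
  assumes ind: "indep_var S Y T Z" and f: "f \<in> borel_measurable (S \<Otimes>\<^sub>M T)"
    and int: "integrable M (\<lambda>\<omega>. f (Y \<omega>, Z \<omega>))"
  shows "expectation (\<lambda>\<omega>. f (Y \<omega>, Z \<omega>)) = expectation (\<lambda>\<omega>. expectation (\<lambda>\<omega>'. f (Y \<omega>, Z \<omega>')))"
proof -
  have Y: "Y \<in> measurable M S" and Z: "Z \<in> measurable M T"
    and eq: "distr M S Y \<Otimes>\<^sub>M distr M T Z = distr M (S \<Otimes>\<^sub>M T) (\<lambda>x. (Y x, Z x))"
    using ind unfolding indep_var_distribution_eq by auto
  interpret Y: prob_space "distr M S Y" by (rule prob_space_distr[OF Y])
  interpret Z: prob_space "distr M T Z" by (rule prob_space_distr[OF Z])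
  interpret YZ: pair_prob_space "distr M S Y" "distr M T Z" ..
  have YZm: "(\<lambda>x. (Y x, Z x)) \<in> measurable M (S \<Otimes>\<^sub>M T)" using Y Z by simp
  have int': "integrable (distr M S Y \<Otimes>\<^sub>M distr M T Z) f"
    unfolding eq using f YZm int by (subst integrable_distr_eq) auto
  have "expectation (\<lambda>\<omega>. f (Y \<omega>, Z \<omega>)) = (\<integral>y. (\<integral>z. f (y, z) \<partial>distr M T Z) \<partial>distr M S Y)"
    using f YZm by (subst YZ.integral_fst'[OF int', unfolded eq]) (simp add: integral_distr)
  also have "\<dots> = (\<integral>\<omega>. (\<integral>z. f (Y \<omega>, z) \<partial>distr M T Z) \<partial>M)"
    using f Y by (intro integral_distr) (auto intro!: Z.borel_measurable_lebesgue_integral)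
  also have "\<dots> = expectation (\<lambda>\<omega>. expectation (\<lambda>\<omega>'. f (Y \<omega>, Z \<omega>')))"
    using f Y Z by (intro Bochner_Integration.integral_cong refl integral_distr)
      (auto dest: measurable_space intro: measurable_compose[OF _ f])
  finally show ?thesis .
qed

end

lemma time_left_pos_less:
  assumes "0 < time_left d t n" "\<And>i. 1 \<le> i \<Longrightarrow> 0 < d i"
  shows "time_left d t n = t - (\<Sum>i=1..n. d i)"
  using assms(1)
proof (induction n)
  case (Suc n)
  then have *: "time_left d t (Suc n) = time_left d t n - d (Suc n)" by (auto simp: max_def split: if_splits)
  then have "0 < time_left d t n" using Suc.prems assms(2)[of "Suc n"] by simp
  with Suc.IH * show ?case by simp
qed simp

lemma time_left_eq_0_mono:
  assumes "time_left d t k = 0" "\<And>i. 1 \<le> i \<Longrightarrow> 0 < d i" "k \<le> n"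
  shows "time_left d t n = 0"
  using assms(3)
proof (induction n rule: dec_induct)
  case (step n)
  then show ?case using assms(2)[of "Suc n"] by simp
qed (rule assms)

lemma time_left_nonneg: "0 \<le> t \<Longrightarrow> 0 \<le> time_left d t n"
  by (cases n) auto

text \<open>
  With \<open>g = g0\<close> this is the value of \<open>g\<close> at the sale price. The two are kept apart because accepted
  offers lie in a bounded range, so that \<open>g\<close> can be taken bounded, while the residual price need not be bounded.
\<close>

definition payoff ::
  "(real \<Rightarrow> real) \<Rightarrow> (real \<Rightarrow> real) \<Rightarrow> (real \<Rightarrow> real) \<Rightarrow> real \<Rightarrow> (nat \<Rightarrow> real) \<Rightarrow> (nat \<Rightarrow> real) \<Rightarrow> real" where
  "payoff m g g0 t d x = (if \<exists>i. accepted m t d x i then g (x (LEAST i. accepted m t d x i)) else g0 (x 0))"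

text \<open>
  The payoff of the process that has consumed the first \<open>k\<close> offers, has time \<open>t\<close> left, considers at most \<open>n\<close>
  further offers and then pays \<open>h\<close> of the time that remains. Interarrival times are \<open>z (Inl i)\<close> and prices
  \<open>z (Inr i)\<close>, as in the joint family of the bidding process.
\<close>

primrec stopped ::
  "(real \<Rightarrow> real) \<Rightarrow> (real \<Rightarrow> real) \<Rightarrow> (real \<Rightarrow> real) \<Rightarrow> (real \<Rightarrow> real) \<Rightarrow>
    nat \<Rightarrow> nat \<Rightarrow> real \<Rightarrow> (nat + nat \<Rightarrow> real) \<Rightarrow> real" where
  "stopped m g g0 h 0 k t z = h t"
| "stopped m g g0 h (Suc n) k t z =
     (if t \<le> z (Inl (Suc k)) then g0 (z (Inr 0))
      else if m (t - z (Inl (Suc k))) \<le> z (Inr (Suc k)) then g (z (Inr (Suc k)))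
      else stopped m g g0 h n (Suc k) (t - z (Inl (Suc k))) z)"

text \<open>
  The indices on which \<open>stopped\<close> depends after \<open>k\<close> offers. They exclude the past, which is what makes the
  continuation independent of the next offer.
\<close>

definition future :: "nat \<Rightarrow> (nat + nat) set" where
  "future k = Inl ` {Suc k..} \<union> Inr ` insert 0 {Suc k..}"

lemma future_simps [simp]: "Inl i \<in> future k \<longleftrightarrow> k < i" "Inr i \<in> future k \<longleftrightarrow> i = 0 \<or> k < i"
  by (auto simp: future_def)

lemma future_Suc: "future (Suc k) \<subseteq> future k"
  by (auto simp: future_def)

lemma stopped_cong:
  assumes "\<And>i. i \<in> future k \<Longrightarrow> z i = z' i"
  shows "stopped m g g0 h n k t z = stopped m g g0 h n k t z'"
  using assms
proof (induction n arbitrary: k t)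
  case (Suc n)
  have "stopped m g g0 h n (Suc k) s z = stopped m g g0 h n (Suc k) s z'" for s
    using Suc.prems future_Suc by (intro Suc.IH) auto
  with Suc.prems show ?case by simp
qed simp

lemma measurable_stopped:
  assumes [measurable]: "m \<in> borel_measurable borel" "g \<in> borel_measurable borel"
    "g0 \<in> borel_measurable borel" "h \<in> borel_measurable borel"
  assumes "future k \<subseteq> B"
  shows "(\<lambda>(t, z). stopped m g g0 h n k t z) \<in> borel_measurable (borel \<Otimes>\<^sub>M PiM B (\<lambda>_. borel))"
  using assms(5)
proof (induction n arbitrary: k)
  case 0
  show ?case unfolding stopped.simps case_prod_beta by measurable
next
  case (Suc n)
  have B: "Inl (Suc k) \<in> B" "Inr (Suc k) \<in> B" "Inr 0 \<in> B" using Suc.prems by auto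
  have [measurable]: "(\<lambda>p. snd p (Inl (Suc k))) \<in> borel_measurable (borel \<Otimes>\<^sub>M PiM B (\<lambda>_. borel))"
    "(\<lambda>p. snd p (Inr (Suc k))) \<in> borel_measurable (borel \<Otimes>\<^sub>M PiM B (\<lambda>_. borel))"
    "(\<lambda>p. snd p (Inr 0)) \<in> borel_measurable (borel \<Otimes>\<^sub>M PiM B (\<lambda>_. borel))"
    by (intro measurable_compose[OF measurable_snd] measurable_component_singleton B)+
  have "future (Suc k) \<subseteq> B" using Suc.prems future_Suc by blast
  note IH = Suc.IH[OF this]
  have "(\<lambda>p. (fst p - snd p (Inl (Suc k)), snd p)) \<in>
      borel \<Otimes>\<^sub>M PiM B (\<lambda>_. borel) \<rightarrow>\<^sub>M borel \<Otimes>\<^sub>M PiM B (\<lambda>_. borel :: real measure)"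
    by measurable
  from measurable_compose[OF this IH] have [measurable]:
    "(\<lambda>p. stopped m g g0 h n (Suc k) (fst p - snd p (Inl (Suc k))) (snd p)) \<in>
      borel_measurable (borel \<Otimes>\<^sub>M PiM B (\<lambda>_. borel))"
    by simp
  show ?case unfolding stopped.simps case_prod_beta by measurable
qed

lemma abs_stopped_le:
  assumes "\<And>x. \<bar>g x\<bar> \<le> K" "\<And>x. \<bar>h x\<bar> \<le> K"
  shows "\<bar>stopped m g g0 h n k t z\<bar> \<le> K + \<bar>g0 (z (Inr 0))\<bar>"
proof (induction n arbitrary: k t)
  case (Suc n)
  have "0 \<le> K" using assms(1)[of 0] by linarith
  then show ?case using Suc assms by (auto intro: add_increasing2)
qed (use assms in \<open>auto intro: add_increasing2\<close>)

text \<open>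
  Once the deadline falls within the next \<open>n\<close> offers, the terminal value \<open>h\<close> is never paid.
\<close>

lemma stopped_eq_payoff:
  assumes d: "\<And>i. 1 \<le> i \<Longrightarrow> 0 < d i" and t: "0 \<le> t"
    and "time_left d t (k + n) = 0" "0 < time_left d t k" "\<And>i. i \<le> k \<Longrightarrow> \<not> accepted m t d x i"
  shows "stopped m g g0 h n k (time_left d t k) (case_sum d x) = payoff m g g0 t d x"
  using assms(3-5)
proof (induction n arbitrary: k)
  case (Suc n)
  define s where "s = time_left d t k - d (Suc k)"
  show ?case
  proof (cases "s \<le> 0")
    case True
    then have "time_left d t (Suc k) = 0" by (simp add: s_def)
    then have "\<not> accepted m t d x i" for i
      using time_left_eq_0_mono[of d t "Suc k" i, OF _ d] Suc.prems(3)[of i]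
      by (cases "i \<le> k") (auto simp: accepted_def)
    then show ?thesis using True by (simp add: payoff_def s_def)
  next
    case False
    then have s: "time_left d t (Suc k) = s" by (simp add: s_def)
    show ?thesis
    proof (cases "m s \<le> x (Suc k)")
      case True
      then have acc: "accepted m t d x (Suc k)" using False by (simp add: accepted_def s del: time_left.simps)
      then have "(LEAST i. accepted m t d x i) = Suc k"
        by (intro Least_equality) (use Suc.prems(3) not_less_eq_eq in blast)+
      then show ?thesis using True False acc by (auto simp: payoff_def s_def)
    next
      case no: False
      then have "\<not> accepted m t d x (Suc k)" by (simp add: accepted_def s del: time_left.simps)
      then have "\<not> accepted m t d x i" if "i \<le> Suc k" for i using Suc.prems(3)[of i] that by (auto simp: le_Suc_eq)
      then have "stopped m g g0 h n (Suc k) (time_left d t (Suc k)) (case_sum d x) = payoff m g g0 t d x"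
        using Suc.prems False s by (intro Suc.IH) auto
      then show ?thesis using no False s by (simp add: s_def del: time_left.simps)
    qed
  qed
qed simp

context bidding_process begin

lemma measurable_D: "1 \<le> i \<Longrightarrow> D i \<in> borel_measurable P"
  using distributed_measurable[OF interarrival] by simp

lemma measurable_X [measurable]: "X i \<in> borel_measurable P"
  using indep by (auto simp: indep_vars_def dest!: bspec[where x="Inr i"])

lemma measurable_time_left: "(\<lambda>\<omega>. time_left (\<lambda>i. D i \<omega>) t n) \<in> borel_measurable P"
proof (induction n)
  case (Suc n)
  have [measurable]: "D (Suc n) \<in> borel_measurable P" by (rule measurable_D) simp
  note Suc[measurable]
  show ?case by simp
qed simp

lemma measurable_accepted:
  assumes [measurable]: "m \<in> borel_measurable borel"
  shows "Measurable.pred P (\<lambda>\<omega>. accepted m t (\<lambda>i. D i \<omega>) (\<lambda>i. X i \<omega>) i)"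
proof -
  note measurable_time_left[measurable]
  show ?thesis unfolding accepted_def by measurable
qed

lemma measurable_payoff:
  assumes [measurable]: "m \<in> borel_measurable borel" "g \<in> borel_measurable borel" "g0 \<in> borel_measurable borel"
  shows "(\<lambda>\<omega>. payoff m g g0 t (\<lambda>i. D i \<omega>) (\<lambda>i. X i \<omega>)) \<in> borel_measurable P"
proof -
  note measurable_accepted[measurable]
  have [measurable]: "(\<lambda>\<omega>. X (LEAST i. accepted m t (\<lambda>i. D i \<omega>) (\<lambda>i. X i \<omega>) i) \<omega>) \<in> borel_measurable P"
    by (rule measurable_compose_countable'[where I=UNIV]) measurable
  show ?thesis unfolding payoff_def by measurable
qed


context
  assumes lam_pos: "0 < lam"
begin

lemma expectation_D:
  assumes "1 \<le> i" and f: "f \<in> borel_measurable borel"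
  shows "expectation (\<lambda>\<omega>. f (D i \<omega>)) = (\<integral>s. exponential_density lam s * f s \<partial>lborel)"
  using distributed_integral[OF interarrival[OF assms(1)], of f] f
  by (simp add: exponential_density_nonneg[OF lam_pos])

lemma AE_D_pos: "AE \<omega> in P. \<forall>i\<ge>1. 0 < D i \<omega>"
proof (rule AE_all_countable[THEN iffD2], rule allI, rule AE_impI)
  fix i :: nat assume i: "1 \<le> i"
  note measurable_D[OF i, measurable]
  have "prob {\<omega> \<in> space P. 0 < D i \<omega>} = 1"
    using exponential_distributedD_gt[OF interarrival[OF i] order.refl lam_pos] by simp
  then show "AE \<omega> in P. 0 < D i \<omega>" by (subst (asm) prob_Collect_eq_1) auto
qed

text \<open>
  Some interarrival time exceeds \<open>t\<close>: the probability that the first \<open>n\<close> do not is the \<open>n\<close>-th power of a number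
  less than \<open>1\<close>.
\<close>

lemma AE_deadline_reached:
  assumes t: "0 \<le> t"
  shows "AE \<omega> in P. \<exists>n. time_left (\<lambda>i. D i \<omega>) t n = 0"
proof -
  define E where "E n = {\<omega> \<in> space P. \<forall>i\<in>{1..n}. D i \<omega> \<le> t}" for n :: nat
  define q where "q = 1 - exp (- t * lam)"
  have q: "0 \<le> q" "q < 1" using t lam_pos by (auto simp: q_def)
  have E_meas: "E n \<in> events" for n
  proof -
    have "{\<omega> \<in> space P. D i \<omega> \<le> t} \<in> events" if "i \<in> {1..n}" for i
      using measurable_D[of i] that by simp
    then show ?thesis unfolding E_def by (intro sets.sets_Collect_finite_All) auto
  qed
  have prob_E: "prob (E n) = q ^ n" for n
  proof (cases "n = 0")
    case True
    then show ?thesis using prob_space by (simp add: E_def)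
  next
    case False
    let ?J = "Inl ` {1..n} :: (nat + nat) set"
    have "prob (\<Inter>j\<in>?J. case_sum D X j -` {..t} \<inter> space P) =
        (\<Prod>j\<in>?J. prob (case_sum D X j -` {..t} \<inter> space P))"
      using False by (intro indep_varsD[OF indep]) auto
    also have "(\<Inter>j\<in>?J. case_sum D X j -` {..t} \<inter> space P) = E n"
      using False by (auto simp: E_def)
    also have "(\<Prod>j\<in>?J. prob (case_sum D X j -` {..t} \<inter> space P)) = (\<Prod>i=1..n. q)"
    proof (subst prod.reindex)
      have "prob (D i -` {..t} \<inter> space P) = q" if "i \<in> {1..n}" for i
      proof -
        have "D i -` {..t} \<inter> space P = {\<omega> \<in> space P. D i \<omega> \<le> t}" by auto
        then show ?thesis
          using exponential_distributedD_le[OF interarrival[of i] t lam_pos] that by (simp add: q_def)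
      qed
      then show "prod ((\<lambda>j. prob (case_sum D X j -` {..t} \<inter> space P)) \<circ> Inl) {1..n} = (\<Prod>i=1..n. q)"
        by (intro prod.cong) auto
    qed simp
    finally show ?thesis by simp
  qed
  have "prob (\<Inter>n. E n) = 0"
  proof (rule LIMSEQ_unique)
    have "decseq E" by (auto simp: decseq_def E_def)
    then show "(\<lambda>n. prob (E n)) \<longlonglongrightarrow> prob (\<Inter>n. E n)"
      using E_meas by (intro finite_Lim_measure_decseq) auto
    show "(\<lambda>n. prob (E n)) \<longlonglongrightarrow> 0" unfolding prob_E using q by (intro LIMSEQ_power_zero) simp
  qed
  then have "AE \<omega> in P. \<omega> \<notin> (\<Inter>n. E n)" using E_meas by (subst (asm) prob_eq_0) auto
  with AE_D_pos AE_space show ?thesis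
  proof eventually_elim
    case (elim \<omega>)
    then obtain n where n: "\<omega> \<notin> E n" by auto
    with elim obtain i where i: "1 \<le> i" "t < D i \<omega>" by (auto simp: E_def not_le)
    have "time_left (\<lambda>i. D i \<omega>) t i \<le> 0"
    proof (rule ccontr)
      assume "\<not> time_left (\<lambda>i. D i \<omega>) t i \<le> 0"
      then have "0 < t - (\<Sum>j=1..i. D j \<omega>)"
        using time_left_pos_less[of "\<lambda>i. D i \<omega>" t i] elim(1) by simp
      moreover have "D i \<omega> \<le> (\<Sum>j=1..i. D j \<omega>)"
        using i elim(1) by (intro member_le_sum) (auto intro: less_imp_le)
      ultimately show False using i by simp
    qed
    with time_left_nonneg[OF t, of "\<lambda>i. D i \<omega>" i] show ?case by (intro exI[of _ i]) simp
  qed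
qed

text \<open>
  The integral form of the equation \<open>h' = lam (r - h)\<close>, with \<open>r u\<close> the expected value just after an arrival that leaves
  time \<open>u\<close>. The density \<open>lam exp (- lam s)\<close> of the arrival is the integrating factor: \<open>- exp (- lam s) (h (t - s) - h 0)\<close>
  is a primitive of the density times \<open>r (t - s) - h 0\<close>.
\<close>

lemma exponential_renewal:
  assumes T: "0 \<le> t" "t \<le> T" and i: "1 \<le> i"
    and r: "r \<in> borel_measurable borel" and bound: "\<And>u. \<bar>r u\<bar> \<le> K"
    and cont: "continuous_on {0..T} h" and C: "countable C"
    and deriv: "\<And>u. 0 < u \<Longrightarrow> u < T \<Longrightarrow> u \<notin> C \<Longrightarrow>
      isCont r u \<and> (h has_real_derivative lam * (r u - h u)) (at u)"
  shows "expectation (\<lambda>\<omega>. if t \<le> D i \<omega> then h 0 else r (t - D i \<omega>)) = h t"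
proof -
  note measurable_D[OF i, measurable] r[measurable]
  define k where "k = (\<lambda>s. lam * exp (- lam * s) * (r (t - s) - h 0))"
  have k_meas [measurable]: "k \<in> borel_measurable borel" unfolding k_def by measurable
  have k_int: "set_integrable lborel {0..t} k"
  proof -
    have bd: "\<bar>k s\<bar> \<le> lam * (K + \<bar>h 0\<bar>)" if "0 \<le> s" for s
    proof -
      have "\<bar>r (t - s) - h 0\<bar> \<le> K + \<bar>h 0\<bar>" using bound[of "t - s"] by linarith
      moreover have "lam * exp (- lam * s) \<le> lam * 1" using that lam_pos by (intro mult_left_mono) auto
      ultimately show ?thesis using lam_pos unfolding k_def abs_mult by (intro mult_mono) auto
    qed
    have "integrable lborel (\<lambda>s. indicator {0..t} s * k s)"
    proof (rule Bochner_Integration.integrable_bound)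
      show "integrable lborel (\<lambda>s. lam * (K + \<bar>h 0\<bar>) * indicator {0..t} s)"
        by (intro integrable_mult_right integrable_real_indicator) (auto simp: emeasure_lborel_Icc_eq)
      show "AE s in lborel. norm (indicator {0..t} s * k s) \<le> norm (lam * (K + \<bar>h 0\<bar>) * indicator {0..t} s)"
        using bd by (intro always_eventually allI) (auto simp: indicator_def intro: order_trans[OF _ abs_ge_self])
    qed simp
    then show ?thesis by (simp add: set_integrable_def)
  qed
  have "(LBINT s:{0..t}. k s) = integral {0..t} k" by (rule set_borel_integral_eq_integral(2)[OF k_int])
  also have "\<dots> = - exp (- lam * t) * (h (t - t) - h 0) - - exp (- lam * 0) * (h (t - 0) - h 0)"
  proof (rule integral_eq_diff_except_countable[OF T(1)])
    show "countable ((\<lambda>u. t - u) ` C)" by (rule countable_image[OF C])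
    show "k integrable_on {0..t}" by (rule set_borel_integral_eq_integral(1)[OF k_int])
    show "continuous_on {0..t} (\<lambda>s. - exp (- lam * s) * (h (t - s) - h 0))"
      using T by (intro continuous_intros continuous_on_compose2[OF cont]) auto
    fix s assume s: "0 < s" "s < t" "s \<notin> (\<lambda>u. t - u) ` C"
    then have "t - s \<notin> C" by force
    with deriv[of "t - s"] s T have 1: "isCont r (t - s)"
      and 2: "(h has_real_derivative lam * (r (t - s) - h (t - s))) (at (t - s))" by auto
    have 3: "((\<lambda>s. h (t - s)) has_real_derivative - (lam * (r (t - s) - h (t - s)))) (at s)"
    proof -
      have "((\<lambda>s. t - s) has_real_derivative - 1) (at s)" by (auto intro!: derivative_eq_intros)
      from DERIV_chain2[where f=h and g="\<lambda>s. t - s" and x=s, OF 2 this] show ?thesis by simp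
    qed
    have 4: "isCont (\<lambda>s. r (t - s)) s"
      by (rule isCont_o2[where g=r]) (use 1 in \<open>auto intro!: continuous_intros\<close>)
    show "isCont k s \<and> ((\<lambda>s. - exp (- lam * s) * (h (t - s) - h 0)) has_real_derivative k s) (at s)"
    proof
      show "isCont k s" unfolding k_def by (intro continuous_intros 4)
      show "((\<lambda>s. - exp (- lam * s) * (h (t - s) - h 0)) has_real_derivative k s) (at s)"
        by (rule derivative_eq_intros 3 refl)+ (simp add: k_def algebra_simps)
    qed
  qed
  finally have k_eq: "(LBINT s:{0..t}. k s) = h t - h 0" by simp
  \<comment> \<open>Subtracting \<open>h 0\<close> removes the contribution of arrivals after the deadline.\<close>
  define e where "e = (\<lambda>s. if t \<le> s then 0 else r (t - s) - h 0)"
  have e_meas [measurable]: "e \<in> borel_measurable borel" unfolding e_def by measurable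
  have e_bound: "\<bar>e s\<bar> \<le> K + \<bar>h 0\<bar>" for s
  proof -
    have "\<bar>r (t - s)\<bar> \<le> K" by (rule bound)
    then show ?thesis by (auto simp: e_def)
  qed
  have "expectation (\<lambda>\<omega>. if t \<le> D i \<omega> then h 0 else r (t - D i \<omega>)) = expectation (\<lambda>\<omega>. h 0 + e (D i \<omega>))"
    by (intro Bochner_Integration.integral_cong) (auto simp: e_def)
  also have "\<dots> = h 0 + expectation (\<lambda>\<omega>. e (D i \<omega>))"
  proof -
    have "integrable P (\<lambda>\<omega>. e (D i \<omega>))"
      by (rule integrable_const_bound[where B="K + \<bar>h 0\<bar>"]) (use e_bound in auto)
    then show ?thesis using prob_space by simp
  qed
  also have "expectation (\<lambda>\<omega>. e (D i \<omega>)) = (\<integral>s. exponential_density lam s * e s \<partial>lborel)"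
    by (rule expectation_D[OF i e_meas])
  also have "\<dots> = (LBINT s:{0..t}. k s)"
    unfolding set_lebesgue_integral_def
  proof (rule integral_cong_AE)
    show "AE s in lborel. exponential_density lam s * e s = indicator {0..t} s *\<^sub>R k s"
      using AE_lborel_singleton[of t]
      by eventually_elim (auto simp: exponential_density_def e_def k_def indicator_def mult.commute)
  qed simp_all
  finally show ?thesis by (simp add: k_eq)
qed

text \<open>
  By induction on the number of offers considered: the next interarrival time, the next offer and the remaining
  family are independent, so the continuation may be replaced by its expectation \<open>h\<close>, and one step of
  the renewal equation gives \<open>h\<close> back.
\<close>

lemma expectation_stopped:
  fixes m g g0 h :: "real \<Rightarrow> real"
  assumes [measurable]: "m \<in> borel_measurable borel" "g \<in> borel_measurable borel"
      "g0 \<in> borel_measurable borel" "h \<in> borel_measurable borel"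
    and g_bound: "\<And>x. \<bar>g x\<bar> \<le> K" and h_bound: "\<And>x. \<bar>h x\<bar> \<le> K"
    and g0_int: "integrable P (\<lambda>\<omega>. g0 (X 0 \<omega>))" and h_0: "h 0 = expectation (\<lambda>\<omega>. g0 (X 0 \<omega>))"
    and renewal: "\<And>t i. 0 \<le> t \<Longrightarrow> t \<le> T \<Longrightarrow> 1 \<le> i \<Longrightarrow>
      expectation (\<lambda>\<omega>. if t \<le> D i \<omega> then h 0
        else (\<integral>x. (if m (t - D i \<omega>) \<le> x then g x else h (t - D i \<omega>)) \<partial>N)) = h t"
    and t: "0 \<le> t" "t \<le> T"
  shows "integrable P (\<lambda>\<omega>. stopped m g g0 h n k t (\<lambda>i. case_sum D X i \<omega>))"
    and "expectation (\<lambda>\<omega>. stopped m g g0 h n k t (\<lambda>i. case_sum D X i \<omega>)) = h t"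
proof -
  define Z where "Z = (\<lambda>\<omega> i. case_sum D X i \<omega>)"
  have Z_meas: "(\<lambda>\<omega>. Z \<omega> i) \<in> borel_measurable P" if "i \<in> {1..} <+> UNIV" for i
    using that measurable_D by (auto simp: Z_def)
  have future_sub: "future k \<subseteq> {1..} <+> UNIV" for k by (auto simp: future_def)
  have Z_restrict: "(\<lambda>\<omega>. restrict (Z \<omega>) A) \<in> measurable P (PiM A (\<lambda>_. borel))"
    if "A \<subseteq> {1..} <+> UNIV" for A
    by (intro measurable_restrict Z_meas) (use that in auto)
  have int: "integrable P (\<lambda>\<omega>. stopped m g g0 h n k t (Z \<omega>))" for n k t
  proof (rule Bochner_Integration.integrable_bound)
    show "integrable P (\<lambda>\<omega>. K + \<bar>g0 (X 0 \<omega>)\<bar>)" by (intro Bochner_Integration.integrable_add integrable_abs g0_int) simp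
    have "(\<lambda>\<omega>. (\<lambda>(t, z). stopped m g g0 h n k t z) (t, restrict (Z \<omega>) (future k))) \<in> borel_measurable P"
      by (rule measurable_compose[OF _ measurable_stopped[where B="future k"]])
        (use future_sub[of k] in \<open>auto intro!: measurable_Pair Z_restrict simp del: Un_iff\<close>)
    moreover have "stopped m g g0 h n k t (restrict (Z \<omega>) (future k)) = stopped m g g0 h n k t (Z \<omega>)" for \<omega>
      by (rule stopped_cong) simp
    ultimately show "(\<lambda>\<omega>. stopped m g g0 h n k t (Z \<omega>)) \<in> borel_measurable P" by simp
    have "\<bar>stopped m g g0 h n k t (Z \<omega>)\<bar> \<le> K + \<bar>g0 (X 0 \<omega>)\<bar>" for \<omega>
      using abs_stopped_le[of g K h m g0 n k t "Z \<omega>"] g_bound h_bound by (simp add: Z_def)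
    then show "AE \<omega> in P. norm (stopped m g g0 h n k t (Z \<omega>)) \<le> norm (K + \<bar>g0 (X 0 \<omega>)\<bar>)"
      by (intro always_eventually allI) (auto intro: order_trans[OF _ abs_ge_self])
  qed
  then show "integrable P (\<lambda>\<omega>. stopped m g g0 h n k t (\<lambda>i. case_sum D X i \<omega>))" by (simp add: Z_def)
  have "expectation (\<lambda>\<omega>. stopped m g g0 h n k t (Z \<omega>)) = h t" using t
  proof (induction n arbitrary: k t)
    case 0
    then show ?case using prob_space by simp
  next
    case (Suc n)
    let ?A = "{Inl (Suc k)} :: (nat + nat) set" and ?B = "{Inr (Suc k)} :: (nat + nat) set"
    let ?F = "future (Suc k)"
    have sub: "?A \<subseteq> {1..} <+> UNIV" "?B \<subseteq> {1..} <+> UNIV" by auto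
    have indep_Z: "indep_var (PiM A (\<lambda>_. borel)) (\<lambda>\<omega>. restrict (Z \<omega>) A) (PiM B (\<lambda>_. borel)) (\<lambda>\<omega>. restrict (Z \<omega>) B)"
      if "A \<inter> B = {}" "A \<subseteq> {1..} <+> UNIV" "B \<subseteq> {1..} <+> UNIV" for A B
      using indep_var_restrict[OF indep that] by (simp add: Z_def)
    have [measurable]: "D (Suc k) \<in> borel_measurable P" by (rule measurable_D) simp
    \<comment> \<open>The value after an arrival at \<open>d\<close> with offer \<open>x\<close>, the continuation being replaced by \<open>h\<close>.\<close>
    define q where "q d x = (if t \<le> d then h 0 else if m (t - d) \<le> x then g x else h (t - d))" for d x
    have q_meas [measurable]: "(\<lambda>p. q (fst p) (snd p)) \<in> borel_measurable (borel \<Otimes>\<^sub>M borel)"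
      unfolding q_def by measurable
    have q_bound: "\<bar>q d x\<bar> \<le> K" for d x using g_bound h_bound by (auto simp: q_def)
    define f where "f p = (if t \<le> fst p (Inl (Suc k)) then g0 (snd p (Inr 0))
      else if m (t - fst p (Inl (Suc k))) \<le> fst p (Inr (Suc k)) then g (fst p (Inr (Suc k)))
      else stopped m g g0 h n (Suc k) (t - fst p (Inl (Suc k))) (snd p))"
      for p :: "(nat + nat \<Rightarrow> real) \<times> (nat + nat \<Rightarrow> real)"
    have f_meas: "f \<in> borel_measurable (PiM (?A \<union> ?B) (\<lambda>_. borel) \<Otimes>\<^sub>M PiM ?F (\<lambda>_. borel))"
    proof -
      let ?S = "PiM (?A \<union> ?B) (\<lambda>_. borel :: real measure) \<Otimes>\<^sub>M PiM ?F (\<lambda>_. borel :: real measure)"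
      have [measurable]: "(\<lambda>p. fst p (Inl (Suc k))) \<in> borel_measurable ?S"
        "(\<lambda>p. fst p (Inr (Suc k))) \<in> borel_measurable ?S" "(\<lambda>p. snd p (Inr 0)) \<in> borel_measurable ?S"
        by (auto intro!: measurable_compose[OF measurable_snd] measurable_compose[OF measurable_fst] measurable_component_singleton)
      have "(\<lambda>p. (t - fst p (Inl (Suc k)), snd p)) \<in> ?S \<rightarrow>\<^sub>M borel \<Otimes>\<^sub>M PiM ?F (\<lambda>_. borel)"
        by measurable
      from measurable_compose[OF this measurable_stopped[of m g g0 h "Suc k" ?F n]]
      have [measurable]: "(\<lambda>p. stopped m g g0 h n (Suc k) (t - fst p (Inl (Suc k))) (snd p)) \<in> borel_measurable ?S"
        by simp
      show ?thesis unfolding f_def by measurable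
    qed
    have f_eq: "stopped m g g0 h (Suc n) k t z = f (restrict z (?A \<union> ?B), restrict z ?F)" for z
    proof -
      have "stopped m g g0 h n (Suc k) s (restrict z ?F) = stopped m g g0 h n (Suc k) s z" for s
        by (rule stopped_cong) simp
      then show ?thesis by (simp add: f_def)
    qed
    have "expectation (\<lambda>\<omega>. stopped m g g0 h (Suc n) k t (Z \<omega>)) =
        expectation (\<lambda>\<omega>. f (restrict (Z \<omega>) (?A \<union> ?B), restrict (Z \<omega>) ?F))"
      by (simp only: f_eq)
    also have "\<dots> = expectation (\<lambda>\<omega>. expectation (\<lambda>\<omega>'. f (restrict (Z \<omega>) (?A \<union> ?B), restrict (Z \<omega>') ?F)))"
    proof (rule indep_var_expectation_iterated)
      show "indep_var (PiM (?A \<union> ?B) (\<lambda>_. borel)) (\<lambda>\<omega>. restrict (Z \<omega>) (?A \<union> ?B))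
          (PiM ?F (\<lambda>_. borel)) (\<lambda>\<omega>. restrict (Z \<omega>) ?F)"
        using sub future_sub by (intro indep_Z) auto
      show "integrable P (\<lambda>\<omega>. f (restrict (Z \<omega>) (?A \<union> ?B), restrict (Z \<omega>) ?F))"
        using int[of "Suc n" k t] by (simp only: f_eq)
      show "f \<in> borel_measurable (PiM (?A \<union> ?B) (\<lambda>_. borel) \<Otimes>\<^sub>M PiM ?F (\<lambda>_. borel))" by (rule f_meas)
    qed
    also have "\<dots> = expectation (\<lambda>\<omega>. q (D (Suc k) \<omega>) (X (Suc k) \<omega>))"
    proof (rule integral_cong_AE)
      have eq: "expectation (\<lambda>\<omega>'. f (restrict (Z \<omega>) (?A \<union> ?B), restrict (Z \<omega>') ?F)) = q (D (Suc k) \<omega>) (X (Suc k) \<omega>)"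
        if pos: "0 < D (Suc k) \<omega>" for \<omega>
      proof -
        have "stopped m g g0 h n (Suc k) s (restrict z ?F) = stopped m g g0 h n (Suc k) s z" for s z
          by (rule stopped_cong) simp
        then have f_simp: "f (restrict (Z \<omega>) (?A \<union> ?B), restrict (Z \<omega>') ?F) =
            (if t \<le> D (Suc k) \<omega> then g0 (X 0 \<omega>')
             else if m (t - D (Suc k) \<omega>) \<le> X (Suc k) \<omega> then g (X (Suc k) \<omega>)
             else stopped m g g0 h n (Suc k) (t - D (Suc k) \<omega>) (Z \<omega>'))" for \<omega>'
          by (simp add: f_def Z_def)
        have "expectation (\<lambda>\<omega>'. stopped m g g0 h n (Suc k) (t - D (Suc k) \<omega>) (Z \<omega>')) = h (t - D (Suc k) \<omega>)"
          if "\<not> t \<le> D (Suc k) \<omega>"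
          by (rule Suc.IH) (use that pos Suc.prems in auto)
        then show ?thesis unfolding f_simp using prob_space by (auto simp: q_def h_0)
      qed
      show "AE \<omega> in P. expectation (\<lambda>\<omega>'. f (restrict (Z \<omega>) (?A \<union> ?B), restrict (Z \<omega>') ?F)) =
          q (D (Suc k) \<omega>) (X (Suc k) \<omega>)"
        using AE_D_pos by eventually_elim (use eq in auto)
      show "(\<lambda>\<omega>. q (D (Suc k) \<omega>) (X (Suc k) \<omega>)) \<in> borel_measurable P"
        using measurable_compose[OF _ q_meas, of "\<lambda>\<omega>. (D (Suc k) \<omega>, X (Suc k) \<omega>)" P] by simp
      show "(\<lambda>\<omega>. expectation (\<lambda>\<omega>'. f (restrict (Z \<omega>) (?A \<union> ?B), restrict (Z \<omega>') ?F))) \<in> borel_measurable P"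
      proof (rule borel_measurable_lebesgue_integral)
        have "(\<lambda>p. f (restrict (Z (fst p)) (?A \<union> ?B), restrict (Z (snd p)) ?F)) \<in> borel_measurable (P \<Otimes>\<^sub>M P)"
          using sub future_sub[of "Suc k"]
          by (intro measurable_compose[OF _ f_meas] measurable_Pair
              measurable_compose[OF measurable_fst Z_restrict] measurable_compose[OF measurable_snd Z_restrict]) blast+
        then show "(\<lambda>(\<omega>, \<omega>'). f (restrict (Z \<omega>) (?A \<union> ?B), restrict (Z \<omega>') ?F)) \<in> borel_measurable (P \<Otimes>\<^sub>M P)"
          by (simp add: case_prod_beta')
      qed
    qed
    also have "\<dots> = expectation (\<lambda>\<omega>. expectation (\<lambda>\<omega>'. q (D (Suc k) \<omega>) (X (Suc k) \<omega>')))"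
    proof -
      have "indep_var borel ((\<lambda>z. z (Inl (Suc k))) \<circ> (\<lambda>\<omega>. restrict (Z \<omega>) ?A))
          borel ((\<lambda>z. z (Inr (Suc k))) \<circ> (\<lambda>\<omega>. restrict (Z \<omega>) ?B))"
        by (rule indep_var_compose[OF indep_Z]) (use sub in auto)
      then have ind: "indep_var borel (D (Suc k)) borel (X (Suc k))" by (simp add: o_def Z_def)
      have "integrable P (\<lambda>\<omega>. q (D (Suc k) \<omega>) (X (Suc k) \<omega>))"
        using measurable_compose[OF _ q_meas, of "\<lambda>\<omega>. (D (Suc k) \<omega>, X (Suc k) \<omega>)" P] q_bound
        by (intro integrable_const_bound[where B=K]) auto
      then show ?thesis using indep_var_expectation_iterated[OF ind q_meas] by simp
    qed
    also have "\<dots> = expectation (\<lambda>\<omega>. if t \<le> D (Suc k) \<omega> then h 0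
        else (\<integral>x. (if m (t - D (Suc k) \<omega>) \<le> x then g x else h (t - D (Suc k) \<omega>)) \<partial>N))"
    proof (intro Bochner_Integration.integral_cong refl)
      fix \<omega>
      have "expectation (\<lambda>\<omega>'. q d (X (Suc k) \<omega>')) = (\<integral>x. q d x \<partial>N)" for d
        using measurable_compose[OF _ q_meas, of "\<lambda>x. (d, x)" borel]
        by (subst offer[of "Suc k", symmetric]) (auto simp: integral_distr)
      moreover have "(\<integral>x. c \<partial>N) = c" for c :: real
        using prob_space_distr[OF measurable_X, of "Suc k"] offer[of "Suc k"]
        by (simp add: prob_space.prob_space)
      ultimately show "expectation (\<lambda>\<omega>'. q (D (Suc k) \<omega>) (X (Suc k) \<omega>')) = (if t \<le> D (Suc k) \<omega> then h 0
        else (\<integral>x. (if m (t - D (Suc k) \<omega>) \<le> x then g x else h (t - D (Suc k) \<omega>)) \<partial>N))"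
        by (simp add: q_def)
    qed
    also have "\<dots> = h t" by (rule renewal) (use Suc.prems in auto)
    finally show ?case .
  qed
  then show "expectation (\<lambda>\<omega>. stopped m g g0 h n k t (\<lambda>i. case_sum D X i \<omega>)) = h t" by (simp add: Z_def)
qed

text \<open>
  The verification principle: a solution of \<open>h' = lam (r - h)\<close>, where \<open>r\<close> averages \<open>g\<close> over accepted offers and \<open>h\<close>
  over rejected ones, is the expected payoff. The stopped payoffs have expectation \<open>h T\<close> and converge
  dominatedly to the payoff.
\<close>

lemma expectation_payoff:
  fixes m g g0 h :: "real \<Rightarrow> real"
  assumes T: "0 \<le> T"
    and [measurable]: "m \<in> borel_measurable borel" "g \<in> borel_measurable borel" "g0 \<in> borel_measurable borel"
    and g_bound: "\<And>x. \<bar>g x\<bar> \<le> K"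
    and g0_int: "integrable N0 g0" and h_0: "h 0 = (\<integral>x. g0 x \<partial>N0)"
    and cont: "continuous_on {0..T} h" and C: "countable C"
    and deriv: "\<And>u. 0 < u \<Longrightarrow> u < T \<Longrightarrow> u \<notin> C \<Longrightarrow>
      isCont r u \<and> (h has_real_derivative lam * (r u - h u)) (at u)"
    and r: "\<And>u. 0 < u \<Longrightarrow> u < T \<Longrightarrow> r u = (\<integral>x. (if m u \<le> x then g x else h u) \<partial>N)"
  shows "integrable P (\<lambda>\<omega>. payoff m g g0 T (\<lambda>i. D i \<omega>) (\<lambda>i. X i \<omega>))"
    and "expectation (\<lambda>\<omega>. payoff m g g0 T (\<lambda>i. D i \<omega>) (\<lambda>i. X i \<omega>)) = h T"
proof -
  interpret N: prob_space N
    using prob_space_distr[OF measurable_X, of 1] offer[of 1] by simp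
  have sets_N [measurable_cong]: "sets N = sets borel" using offer[of 1] by (metis order_refl sets_distr)
  obtain K' where K': "\<And>u. 0 \<le> u \<Longrightarrow> u \<le> T \<Longrightarrow> \<bar>h u\<bar> \<le> K'"
    using compact_imp_bounded[OF compact_continuous_image[OF cont compact_Icc]]
    by (force simp: bounded_iff)
  define L where "L = max K K'"
  have L: "0 \<le> L" "\<bar>g x\<bar> \<le> L" for x
    using g_bound[of x] g_bound[of 0] by (auto simp: L_def)
  \<comment> \<open>Cut off outside \<open>{0..T}\<close>, the solution is measurable and bounded on the whole line.\<close>
  define h1 where "h1 = (\<lambda>u. indicator {0..T} u *\<^sub>R h u)"
  have h1_meas [measurable]: "h1 \<in> borel_measurable borel"
    unfolding h1_def by (rule borel_measurable_continuous_on_indicator[OF _ cont]) simp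
  have h1_bound: "\<bar>h1 u\<bar> \<le> L" for u
    using K'[of u] L(1) by (auto simp: h1_def indicator_def L_def)
  have h1_eq: "h1 u = h u" if "0 \<le> u" "u \<le> T" for u using that by (simp add: h1_def)
  then have h1_eq': "h1 u = h u" if "0 < u" "u < T" for u using that by simp
  define R where "R u = (\<integral>x. (if m u \<le> x then g x else h1 u) \<partial>N)" for u
  have R_eq: "R u = r u" if "0 < u" "u < T" for u
    unfolding R_def h1_eq'[OF that] r[OF that] ..
  have R_meas: "R \<in> borel_measurable borel"
    unfolding R_def by (rule N.borel_measurable_lebesgue_integral) measurable
  have R_bound: "\<bar>R u\<bar> \<le> L" for u
  proof -
    have "\<bar>R u\<bar> \<le> (\<integral>x. L \<partial>N)"
      unfolding R_def
      by (rule order_trans[OF integral_abs_bound integral_mono'])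
        (use L h1_bound in auto)
    then show ?thesis by (simp add: N.prob_space)
  qed
  have g0_P: "integrable P (\<lambda>\<omega>. g0 (X 0 \<omega>))"
    using g0_int unfolding residual[symmetric] by (simp add: integrable_distr_eq)
  have h1_0: "h1 0 = expectation (\<lambda>\<omega>. g0 (X 0 \<omega>))"
    using T by (simp add: h1_eq h_0 residual[symmetric] integral_distr)
  have renewal: "expectation (\<lambda>\<omega>. if t \<le> D i \<omega> then h1 0 else R (t - D i \<omega>)) = h1 t"
    if "0 \<le> t" "t \<le> T" "1 \<le> i" for t i
  proof (rule exponential_renewal[OF that R_meas R_bound _ C])
    show "continuous_on {0..T} h1" using cont by (rule continuous_on_eq) (simp add: h1_eq)
    fix u assume u: "0 < u" "u < T" "u \<notin> C"
    have near: "\<forall>\<^sub>F v in nhds u. v \<in> {0<..<T}" using u by (intro eventually_nhds_in_open) auto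
    then have R_r: "\<forall>\<^sub>F v in nhds u. R v = r v" and h1_h: "\<forall>\<^sub>F v in nhds u. h1 v = h v"
      by (auto elim!: eventually_mono simp: R_eq h1_eq')
    have "isCont R u = isCont r u" by (rule isCont_cong[OF R_r])
    moreover have "R u = r u" "h1 u = h u" using u by (auto simp: R_eq h1_eq')
    moreover have "(h1 has_real_derivative d) (at u) = (h has_real_derivative d) (at u)" for d
      by (rule DERIV_cong_ev[OF refl h1_h refl])
    ultimately show "isCont R u \<and> (h1 has_real_derivative lam * (R u - h1 u)) (at u)"
      using deriv[OF u] by simp
  qed
  have m_: "m \<in> borel_measurable borel" and g_: "g \<in> borel_measurable borel" and g0_: "g0 \<in> borel_measurable borel"
    by measurable
  note stopped = expectation_stopped[OF m_ g_ g0_ h1_meas L(2) h1_bound g0_P h1_0 renewal[unfolded R_def] T order.refl]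
  let ?S = "\<lambda>n \<omega>. stopped m g g0 h1 n 0 T (\<lambda>i. case_sum D X i \<omega>)"
  let ?p = "\<lambda>\<omega>. payoff m g g0 T (\<lambda>i. D i \<omega>) (\<lambda>i. X i \<omega>)"
  have lim: "AE \<omega> in P. (\<lambda>n. ?S n \<omega>) \<longlonglongrightarrow> ?p \<omega>"
    using AE_deadline_reached[OF T] AE_D_pos
  proof eventually_elim
    case (elim \<omega>)
    then obtain n0 where n0: "time_left (\<lambda>i. D i \<omega>) T n0 = 0" by blast
    have "?S n \<omega> = ?p \<omega>" if "max n0 1 \<le> n" for n
    proof (cases "T = 0")
      case True
      obtain n' where n': "n = Suc n'" using \<open>max n0 1 \<le> n\<close> by (cases n) auto
      have "time_left (\<lambda>i. D i \<omega>) 0 i = 0" for i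
        using time_left_eq_0_mono[of "\<lambda>i. D i \<omega>" 0 0 i] elim(2) by simp
      then show ?thesis using True elim(2) n' by (auto simp: payoff_def accepted_def intro: less_imp_le)
    next
      case False
      have "time_left (\<lambda>i. D i \<omega>) T n = 0"
        using time_left_eq_0_mono[of "\<lambda>i. D i \<omega>" T n0 n] n0 elim(2) that by simp
      moreover have "(\<lambda>i. case_sum D X i \<omega>) = case_sum (\<lambda>i. D i \<omega>) (\<lambda>i. X i \<omega>)"
        by (auto simp: fun_eq_iff split: sum.split)
      ultimately show ?thesis
        using stopped_eq_payoff[of "\<lambda>i. D i \<omega>" T 0 n m "\<lambda>i. X i \<omega>" g g0 h1] elim(2) False T
        by (simp add: accepted_def)
    qed
    then show ?case by (intro tendsto_eventually eventually_sequentiallyI)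
  qed
  have bound: "AE \<omega> in P. norm (?S n \<omega>) \<le> L + \<bar>g0 (X 0 \<omega>)\<bar>" for n
    using abs_stopped_le[of g L h1 m g0 n 0 T "\<lambda>i. case_sum D X i _", OF L(2) h1_bound]
    by (intro always_eventually allI) simp
  have p_meas: "?p \<in> borel_measurable P" by (rule measurable_payoff) measurable
  have L_int: "integrable P (\<lambda>\<omega>. L + \<bar>g0 (X 0 \<omega>)\<bar>)"
    by (intro Bochner_Integration.integrable_add integrable_abs g0_P) simp
  note dct = integrable_dominated_convergence[OF p_meas _ L_int lim bound]
     integral_dominated_convergence[OF p_meas _ L_int lim bound]
  show "integrable P ?p" by (rule dct(1)) (use stopped(1) in auto)
  have "(\<lambda>n. expectation (?S n)) \<longlonglongrightarrow> expectation ?p" by (rule dct(2)) (use stopped(1) in auto)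
  moreover have "expectation (?S n) = h1 T" for n by (rule stopped(2))
  ultimately have "expectation ?p = h1 T" by (simp add: LIMSEQ_const_iff)
  then show "expectation ?p = h T" using T by (simp add: h1_eq)
qed

end
end

section \<open>The variance of the sale price\<close>

context selling begin

definition ratio_integral :: "real \<Rightarrow> real" where
  "ratio_integral x = integral {m0..x} (\<lambda>w. excess_sq w / (excess w)\<^sup>2)"

text \<open>
  Variation of constants for \<open>v' = lam (excess_sq mu - P(X \<ge> mu) v)\<close>, \<open>v 0 = V0\<close>, in the variable \<open>mu t\<close>
  instead of \<open>t\<close>.
\<close>

definition price_variance :: "real \<Rightarrow> real \<Rightarrow> real" where
  "price_variance V0 t = excess (mu t) * (V0 / excess m0 + ratio_integral (mu t))"

lemma continuous_on_ratio: "continuous_on {m0..<M} (\<lambda>w. excess_sq w / (excess w)\<^sup>2)"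
  by (intro continuous_intros continuous_on_excess continuous_at_imp_continuous_on ballI isCont_excess_sq)
     (use excess_pos in \<open>force dest: less_imp_neq\<close>)

lemma ratio_integral_has_derivative:
  assumes "m0 < x" "x < M"
  shows "(ratio_integral has_real_derivative excess_sq x / (excess x)\<^sup>2) (at x)"
  unfolding ratio_integral_def by (rule integral_has_real_derivative_Ico[OF continuous_on_ratio assms])

lemma continuous_on_ratio_integral: "continuous_on {m0..<M} ratio_integral"
  unfolding ratio_integral_def by (rule continuous_on_integral_Ico[OF continuous_on_ratio])

lemma ratio_integral_m0: "ratio_integral m0 = 0"
  by (simp add: ratio_integral_def)

lemma price_variance_0: "price_variance V0 0 = V0"
  using excess_pos[OF m0_less] by (simp add: price_variance_def mu_0 ratio_integral_m0)

lemma continuous_on_price_variance: "continuous_on {0..} (price_variance V0)"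
  unfolding price_variance_def
  by (intro continuous_intros continuous_on_compose2[OF continuous_on_excess[of UNIV]]
      continuous_on_compose2[OF continuous_on_ratio_integral] continuous_on_mu)
    (use mu_ge mu_less excess_pos[OF m0_less] in auto)

lemma price_variance_has_derivative:
  assumes t: "0 < t" and cont: "isCont (cdf N) (mu t)"
  shows "(price_variance V0 has_real_derivative
    lam * (excess_sq (mu t) - (1 - cdf N (mu t)) * price_variance V0 t)) (at t)"
proof -
  have mu: "m0 < mu t" "mu t < M" using mu_gt mu_less t by auto
  then have pos: "0 < excess (mu t)" by (simp add: excess_pos)
  note d1 = DERIV_chain2[OF excess_has_derivative[OF cont] mu_has_derivative[OF t]]
  note d2 = DERIV_chain2[OF ratio_integral_has_derivative[OF mu] mu_has_derivative[OF t]]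
  define S where "S = V0 / excess m0 + ratio_integral (mu t)"
  have "(price_variance V0 has_real_derivative
      (- (1 - cdf N (mu t)) * (lam * excess (mu t))) * S +
      (excess_sq (mu t) / (excess (mu t))\<^sup>2 * (lam * excess (mu t))) * excess (mu t)) (at t)"
    unfolding price_variance_def S_def
    by (rule derivative_eq_intros d1 d2 refl)+ simp
  also have "(- (1 - cdf N (mu t)) * (lam * excess (mu t))) * S +
      (excess_sq (mu t) / (excess (mu t))\<^sup>2 * (lam * excess (mu t))) * excess (mu t) =
      lam * (excess_sq (mu t) - (1 - cdf N (mu t)) * price_variance V0 t)"
  proof -
    have "excess_sq (mu t) / (excess (mu t))\<^sup>2 * (lam * excess (mu t)) * excess (mu t) = lam * excess_sq (mu t)"
      using pos by (simp add: power2_eq_square)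
    moreover have "price_variance V0 t = excess (mu t) * S" by (simp add: price_variance_def S_def)
    ultimately show ?thesis by (simp only:) (simp add: algebra_simps)
  qed
  finally show ?thesis .
qed

text \<open>
  The policy is injective, so it meets each of the countably many atoms of the offer law at most once.
\<close>

lemma countable_mu_discontinuities: "countable {t. 0 < t \<and> \<not> isCont (cdf N) (mu t)}"
proof (rule countable_image_inj_on)
  show "countable (mu ` {t. 0 < t \<and> \<not> isCont (cdf N) (mu t)})"
    by (rule countable_subset[OF _ countable_discontinuities]) auto
  show "inj_on mu {t. 0 < t \<and> \<not> isCont (cdf N) (mu t)}" by (rule inj_on_subset[OF inj_on_mu]) auto
qed

end

text \<open>
  The residual price is assumed to have mean \<open>m0\<close>; this is the initial condition that makes the policy equal to
  the expected sale price.
\<close>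

locale optimal_sale = offers: selling N M lam m0 + bidding_process P lam N N0 D X
  for N :: "real measure" and M lam m0 :: real and P :: "'a measure" and N0 and D X +
  assumes residual_integrable: "integrable N0 (\<lambda>x. x)" and residual_mean: "(\<integral>x. x \<partial>N0) = m0"
begin

definition sale :: "real \<Rightarrow> 'a \<Rightarrow> real" where
  "sale t \<omega> = sale_price offers.mu t (\<lambda>i. D i \<omega>) (\<lambda>i. X i \<omega>)"

lemma prob_space_residual: "prob_space N0"
  using prob_space_distr[OF measurable_X, of 0] residual by simp

lemma AE_offers_le: "AE \<omega> in P. \<forall>i\<ge>1. X i \<omega> \<le> M"
proof (rule AE_all_countable[THEN iffD2], rule allI, rule AE_impI)
  fix i :: nat assume i: "1 \<le> i"
  have "AE y in distr P borel (X i). y \<le> M" unfolding offer[OF i] by (rule offers.AE_le_upper_end)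
  then show "AE \<omega> in P. X i \<omega> \<le> M" by (subst (asm) AE_distr_iff) auto
qed

text \<open>
  The verification principle for a function of the sale price. Accepted offers lie in \<open>{m0..M}\<close>, so \<open>G\<close> only
  has to be bounded there.
\<close>

lemma expectation_sale:
  fixes G h :: "real \<Rightarrow> real"
  assumes T: "0 \<le> T" and G [measurable]: "G \<in> borel_measurable borel"
    and bound: "\<And>x. m0 \<le> x \<Longrightarrow> x \<le> M \<Longrightarrow> \<bar>G x\<bar> \<le> K"
    and G_int: "integrable N0 G" and h_0: "h 0 = (\<integral>x. G x \<partial>N0)"
    and cont: "continuous_on {0..T} h" and C: "countable C"
    and deriv: "\<And>u. 0 < u \<Longrightarrow> u < T \<Longrightarrow> u \<notin> C \<Longrightarrow>
      isCont r u \<and> (h has_real_derivative lam * (r u - h u)) (at u)"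
    and r: "\<And>u. 0 < u \<Longrightarrow> u < T \<Longrightarrow> r u = (\<integral>x. (if offers.mu u \<le> x then G x else h u) \<partial>N)"
  shows "integrable P (\<lambda>\<omega>. G (sale T \<omega>))" and "expectation (\<lambda>\<omega>. G (sale T \<omega>)) = h T"
proof -
  \<comment> \<open>Thresholds are compared at positive times only; the cut-off makes the policy measurable on the line.\<close>
  define m where "m = (\<lambda>u. indicator {0..} u *\<^sub>R offers.mu u)"
  have m_meas: "m \<in> borel_measurable borel"
    unfolding m_def by (rule borel_measurable_continuous_on_indicator[OF _ offers.continuous_on_mu]) simp
  define clip where "clip x = max m0 (min x M)" for x
  have clip_range: "m0 \<le> clip x" "clip x \<le> M" for x using offers.m0_less by (auto simp: clip_def)
  have clip_id: "clip x = x" if "m0 \<le> x" "x \<le> M" for x using that by (simp add: clip_def)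
  have clip_meas [measurable]: "clip \<in> borel_measurable borel" unfolding clip_def by measurable
  have acc: "accepted m T d x = accepted offers.mu T d x" for d x
    by (auto simp: accepted_def m_def fun_eq_iff)
  have payoff_sale: "payoff m (\<lambda>x. G (clip x)) G T d x = G (sale_price offers.mu T d x)"
    if x: "\<forall>i\<ge>1. x i \<le> M" for d x
  proof (cases "\<exists>i. accepted offers.mu T d x i")
    case True
    define j where "j = (LEAST i. accepted offers.mu T d x i)"
    have "accepted offers.mu T d x j" unfolding j_def by (rule LeastI_ex[OF True])
    then have "m0 \<le> x j" "x j \<le> M"
      using offers.mu_ge[of "time_left d T j"] x by (auto simp: accepted_def)
    then show ?thesis using True by (simp add: payoff_def sale_price_def acc j_def[symmetric] clip_id)
  qed (simp add: payoff_def sale_price_def acc)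
  have AE_eq: "AE \<omega> in P. payoff m (\<lambda>x. G (clip x)) G T (\<lambda>i. D i \<omega>) (\<lambda>i. X i \<omega>) = G (sale T \<omega>)"
    using AE_offers_le by eventually_elim (use payoff_sale in \<open>auto simp: sale_def\<close>)
  have r': "r u = (\<integral>x. (if m u \<le> x then G (clip x) else h u) \<partial>N)" if u: "0 < u" "u < T" for u
  proof -
    have [simp]: "m u = offers.mu u" using u by (simp add: m_def)
    have [measurable]: "G \<in> borel_measurable N" "clip \<in> borel_measurable N" by simp_all
    have [measurable]: "(\<lambda>x. G (clip x)) \<in> borel_measurable N"
      by (rule offers.measurable_finite_borel) measurable
    have "(\<integral>x. (if offers.mu u \<le> x then G x else h u) \<partial>N) = (\<integral>x. (if m u \<le> x then G (clip x) else h u) \<partial>N)"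
    proof (rule integral_cong_AE)
      show "AE x in N. (if offers.mu u \<le> x then G x else h u) = (if m u \<le> x then G (clip x) else h u)"
        using offers.AE_le_upper_end
        by eventually_elim (use u offers.mu_ge[of u] clip_id in auto)
    qed (simp_all, measurable)
    then show ?thesis using r[OF u] by simp
  qed
  have clip_bound: "\<bar>G (clip x)\<bar> \<le> K" for x by (intro bound clip_range)
  have G_clip: "(\<lambda>x. G (clip x)) \<in> borel_measurable borel" by measurable
  note main = expectation_payoff[OF offers.lam_pos T m_meas G_clip G clip_bound G_int h_0 cont C deriv r']
  have sale_meas: "sale T \<in> borel_measurable P"
  proof -
    have "(\<lambda>\<omega>. payoff m (\<lambda>x. x) (\<lambda>x. x) T (\<lambda>i. D i \<omega>) (\<lambda>i. X i \<omega>)) \<in> borel_measurable P"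
      using m_meas by (intro measurable_payoff) auto
    moreover have "sale T = (\<lambda>\<omega>. payoff m (\<lambda>x. x) (\<lambda>x. x) T (\<lambda>i. D i \<omega>) (\<lambda>i. X i \<omega>))"
      by (simp add: fun_eq_iff payoff_def sale_def sale_price_def acc)
    ultimately show ?thesis by simp
  qed
  have p_meas: "(\<lambda>\<omega>. payoff m (\<lambda>x. G (clip x)) G T (\<lambda>i. D i \<omega>) (\<lambda>i. X i \<omega>)) \<in> borel_measurable P"
    by (rule measurable_payoff[OF m_meas G_clip G])
  have GS_meas: "(\<lambda>\<omega>. G (sale T \<omega>)) \<in> borel_measurable P" using sale_meas by measurable
  show "integrable P (\<lambda>\<omega>. G (sale T \<omega>))"
    using main(1) integrable_cong_AE[OF p_meas GS_meas AE_eq] by blast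
  show "expectation (\<lambda>\<omega>. G (sale T \<omega>)) = h T"
    using main(2) integral_cong_AE[OF p_meas GS_meas AE_eq] by simp
qed

lemma expectation_sale_price:
  assumes T: "0 \<le> T"
  shows "expectation (sale T) = offers.mu T"
proof -
  have "expectation (\<lambda>\<omega>. sale T \<omega>) = offers.mu T"
  proof (rule expectation_sale(2)[OF T, where G="\<lambda>x. x" and h=offers.mu and C="{}" and K="\<bar>m0\<bar> + \<bar>M\<bar>"
        and r="\<lambda>u. offers.mu u + offers.excess (offers.mu u)"])
    show "continuous_on {0..T} offers.mu" by (rule continuous_on_subset[OF offers.continuous_on_mu]) auto
    show "offers.mu 0 = (\<integral>x. x \<partial>N0)" by (simp add: offers.mu_0 residual_mean)
    show "\<bar>x\<bar> \<le> \<bar>m0\<bar> + \<bar>M\<bar>" if "m0 \<le> x" "x \<le> M" for x using that by linarith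
    fix u :: real assume u: "0 < u"
    have "isCont (\<lambda>u. offers.mu u + offers.excess (offers.mu u)) u"
      by (rule isCont_add[OF offers.isCont_mu[OF u] isCont_o2[OF offers.isCont_mu[OF u] offers.isCont_excess]])
    moreover have "(offers.mu has_real_derivative
        lam * (offers.mu u + offers.excess (offers.mu u) - offers.mu u)) (at u)"
      using offers.mu_has_derivative[OF u] by (simp only: add_diff_cancel_left')
    ultimately show "isCont (\<lambda>u. offers.mu u + offers.excess (offers.mu u)) u \<and>
        (offers.mu has_real_derivative lam * (offers.mu u + offers.excess (offers.mu u) - offers.mu u)) (at u)" ..
    have "(\<integral>x. (if offers.mu u \<le> x then x else offers.mu u) \<partial>N) = (\<integral>x. offers.mu u + max (x - offers.mu u) 0 \<partial>N)"
      by (intro Bochner_Integration.integral_cong) auto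
    also have "\<dots> = offers.mu u + offers.excess (offers.mu u)"
      using offers.prob_space offers.integrable_excess[of "offers.mu u"] by (simp add: offers.excess_def)
    finally show "offers.mu u + offers.excess (offers.mu u) = (\<integral>x. (if offers.mu u \<le> x then x else offers.mu u) \<partial>N)"
      by (rule sym)
  qed (simp_all add: residual_integrable)
  then show ?thesis by simp
qed

text \<open>
  The verification principle is applied to \<open>(S - b)\<^sup>2\<close> for the fixed number \<open>b = mu T\<close>, the mean at the horizon \<open>T\<close>. The
  solution is \<open>v + (mu - b)\<^sup>2\<close>, whose second summand vanishes at \<open>T\<close>.
\<close>

lemma variance_sale_price:
  assumes T: "0 \<le> T" and sq: "integrable N0 (\<lambda>x. x\<^sup>2)"
  shows "variance (sale T) = offers.price_variance (prob_space.variance N0 (\<lambda>x. x)) T"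
proof -
  interpret N0: prob_space N0 by (rule prob_space_residual)
  define V0 where "V0 = N0.variance (\<lambda>x. x)"
  define b where "b = offers.mu T"
  define v where "v = offers.price_variance V0"
  define h where "h u = v u + (offers.mu u - b)\<^sup>2" for u
  define r where "r u = h u + offers.excess_sq (offers.mu u) +
    2 * (offers.mu u - b) * offers.excess (offers.mu u) - v u * offers.prob {offers.mu u..}" for u
  define C where "C = {t. 0 < t \<and> \<not> isCont (cdf N) (offers.mu t)}"
  have int_b: "integrable N0 (\<lambda>x. (x - b)\<^sup>2)"
    using sq residual_integrable by (simp add: power2_diff)
  have "expectation (\<lambda>\<omega>. (sale T \<omega> - b)\<^sup>2) = h T"
  proof (rule expectation_sale(2)[OF T, where C=C and r=r])
    show "\<bar>(x - b)\<^sup>2\<bar> \<le> (\<bar>m0\<bar> + \<bar>M\<bar> + \<bar>b\<bar>)\<^sup>2" if "m0 \<le> x" "x \<le> M" for x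
    proof -
      have "\<bar>x - b\<bar> \<le> \<bar>m0\<bar> + \<bar>M\<bar> + \<bar>b\<bar>" using that by linarith
      then have "\<bar>x - b\<bar>\<^sup>2 \<le> (\<bar>m0\<bar> + \<bar>M\<bar> + \<bar>b\<bar>)\<^sup>2" by (intro power_mono) auto
      then show ?thesis by simp
    qed
    show "h 0 = (\<integral>x. (x - b)\<^sup>2 \<partial>N0)"
    proof -
      have "V0 = N0.expectation (\<lambda>x. x\<^sup>2) - m0\<^sup>2"
        using N0.variance_eq[OF residual_integrable sq] by (simp only: V0_def residual_mean)
      moreover have "(\<integral>x. (x - b)\<^sup>2 \<partial>N0) = N0.expectation (\<lambda>x. x\<^sup>2) - 2 * m0 * b + b\<^sup>2"
      proof -
        have "(\<integral>x. (x - b)\<^sup>2 \<partial>N0) = (\<integral>x. x\<^sup>2 - 2 * b * x + b\<^sup>2 \<partial>N0)"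
          by (intro Bochner_Integration.integral_cong refl) (simp add: power2_diff)
        also have "\<dots> = N0.expectation (\<lambda>x. x\<^sup>2) - 2 * b * m0 + b\<^sup>2"
          using sq residual_integrable N0.prob_space by (simp add: residual_mean)
        finally show ?thesis by simp
      qed
      ultimately show ?thesis
        by (simp add: h_def v_def offers.price_variance_0 offers.mu_0 power2_diff)
    qed
    show "continuous_on {0..T} h" unfolding h_def v_def
      by (intro continuous_intros continuous_on_subset[OF offers.continuous_on_price_variance]
          continuous_on_subset[OF offers.continuous_on_mu]) auto
    show "countable C" unfolding C_def by (rule offers.countable_mu_discontinuities)
    fix u :: real assume u: "0 < u"
    show "isCont r u \<and> (h has_real_derivative lam * (r u - h u)) (at u)" if "u \<notin> C"
    proof
      have cdf: "isCont (cdf N) (offers.mu u)" using that u by (simp add: C_def)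
      note dv = offers.price_variance_has_derivative[OF u cdf, of V0, folded v_def]
      note dmu = offers.mu_has_derivative[OF u]
      have h_deriv: "(h has_real_derivative lam * (offers.excess_sq (offers.mu u) - (1 - cdf N (offers.mu u)) * v u) +
          2 * (offers.mu u - b) * (lam * offers.excess (offers.mu u))) (at u)"
        unfolding h_def by (rule derivative_eq_intros dv dmu refl)+ simp
      have "lam * (offers.excess_sq (offers.mu u) - (1 - cdf N (offers.mu u)) * v u) +
          2 * (offers.mu u - b) * (lam * offers.excess (offers.mu u)) = lam * (r u - h u)"
        by (simp add: r_def offers.isCont_prob_atLeast(2)[OF cdf] algebra_simps)
      with h_deriv show dh: "(h has_real_derivative lam * (r u - h u)) (at u)" by simp
      note c_mu = offers.isCont_mu[OF u]
      have c: "isCont (\<lambda>u. offers.excess (offers.mu u)) u" "isCont (\<lambda>u. offers.excess_sq (offers.mu u)) u"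
        "isCont (\<lambda>u. offers.prob {offers.mu u..}) u"
        using isCont_o2[OF c_mu offers.isCont_excess] isCont_o2[OF c_mu offers.isCont_excess_sq]
          isCont_o2[OF c_mu offers.isCont_prob_atLeast(1)[OF cdf]] by simp_all
      show "isCont r u" unfolding r_def
        by (intro isCont_add isCont_diff isCont_mult continuous_const c c_mu DERIV_isCont[OF dh] DERIV_isCont[OF dv])
    qed
    let ?m = "offers.mu u"
    have "(if ?m \<le> x then (x - b)\<^sup>2 else h u) = h u + (max (x - ?m) 0)\<^sup>2 + 2 * (?m - b) * max (x - ?m) 0
        - v u * indicator {?m..} x" for x
      by (auto simp: h_def power2_eq_square algebra_simps)
    then have "(\<integral>x. (if ?m \<le> x then (x - b)\<^sup>2 else h u) \<partial>N) =
        (\<integral>x. h u + (max (x - ?m) 0)\<^sup>2 + 2 * (?m - b) * max (x - ?m) 0 - v u * indicator {?m..} x \<partial>N)"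
      by simp
    also have "\<dots> = r u"
    proof -
      have "integrable N (indicator {?m..} :: real \<Rightarrow> real)"
        by (rule offers.integrable_const_bound[where B=1]) (auto simp: indicator_def)
      then show ?thesis
        using offers.integrable_excess[of ?m] offers.integrable_excess_sq[of ?m] offers.prob_space
        by (simp add: r_def offers.excess_def offers.excess_sq_def)
    qed
    finally show "r u = (\<integral>x. (if ?m \<le> x then (x - b)\<^sup>2 else h u) \<partial>N)" by (rule sym)
  qed (simp_all add: int_b)
  then show ?thesis
    using expectation_sale_price[OF T] by (simp add: h_def b_def v_def V0_def)
qed

end

section \<open>Asymptotics under a power tail\<close>

locale power_tail = selling N M lam m0 for N :: "real measure" and M lam m0 :: real +
  fixes p c :: real
  assumes p_pos: "0 < p" and c_pos: "0 < c"
    and excess_tail: "((\<lambda>x. excess x / (M - x) powr (p + 1)) \<longlongrightarrow> c) (at_left M)"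
begin

text \<open>
  The growth rate of \<open>(M - mu t) powr (- p)\<close>; see \<open>policy_gap_powr\<close>.
\<close>

definition rate :: real where "rate = lam * p * c"

lemma rate_pos: "0 < rate"
  using lam_pos p_pos c_pos by (simp add: rate_def)

lemma near_upper_end: "\<forall>\<^sub>F x in at_left M. m0 < x \<and> x < M"
  using eventually_at_left_real[OF m0_less] by (rule eventually_mono) auto

lemma gap_to_0: "((\<lambda>x. M - x) \<longlongrightarrow> 0) (at_left M)"
proof -
  have "((\<lambda>x. M - x) \<longlongrightarrow> M - M) (at_left M)" by (intro tendsto_intros)
  then show ?thesis by simp
qed

lemma gap_powr_to_0: assumes "0 < a" shows "((\<lambda>x. (M - x) powr a) \<longlongrightarrow> 0) (at_left M)"
proof (rule tendsto_zero_powrI[OF gap_to_0 tendsto_const _ assms])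
  show "\<forall>\<^sub>F x in at_left M. 0 \<le> M - x" using near_upper_end by eventually_elim simp
qed

lemma neg_ln_gap_at_top: "filterlim (\<lambda>x. - ln (M - x)) at_top (at_left M)"
proof -
  have "filterlim (\<lambda>x. M - x) (at_right 0) (at_left M)"
    unfolding filterlim_at using gap_to_0 near_upper_end by (auto elim!: eventually_mono)
  from filterlim_compose[OF ln_at_0 this] show ?thesis by (simp add: filterlim_uminus_at_bot)
qed

lemma gap_powr_has_derivative:
  assumes "x < M"
  shows "((\<lambda>x. (M - x) powr a) has_real_derivative - a * (M - x) powr (a - 1)) (at x)"
  using assms by (auto intro!: derivative_eq_intros)

text \<open>
  The derivative of \<open>(M - mu t) powr (- p)\<close> is \<open>lam p\<close> times the ratio that tends to \<open>c\<close> by the tail hypothesis.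
\<close>

lemma policy_gap_powr: "((\<lambda>t. (M - mu t) powr (- p) / t) \<longlongrightarrow> rate) at_top"
proof (rule lhospital_at_top_at_top)
  have "((\<lambda>t. excess (mu t) / (M - mu t) powr (p + 1)) \<longlongrightarrow> c) at_top"
    by (rule filterlim_compose[OF excess_tail mu_at_top])
  then have "((\<lambda>t. lam * p * (excess (mu t) / (M - mu t) powr (p + 1))) \<longlongrightarrow> rate) at_top"
    unfolding rate_def by (intro tendsto_intros)
  then show "((\<lambda>t. lam * p * (excess (mu t) / (M - mu t) powr (p + 1)) / 1) \<longlongrightarrow> rate) at_top" by simp
  show "\<forall>\<^sub>F t in at_top. ((\<lambda>t. (M - mu t) powr (- p)) has_real_derivative
      lam * p * (excess (mu t) / (M - mu t) powr (p + 1))) (at t)"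
    using eventually_gt_at_top[of 0]
  proof eventually_elim
    case (elim t)
    then have "mu t < M" using mu_less by simp
    from DERIV_chain2[OF gap_powr_has_derivative[OF this, of "- p"] mu_has_derivative[OF elim]]
    have "((\<lambda>t. (M - mu t) powr (- p)) has_real_derivative p * (M - mu t) powr (- p - 1) * (lam * excess (mu t))) (at t)"
      by simp
    moreover have "(M - mu t) powr (- p - 1) = 1 / (M - mu t) powr (p + 1)"
      by (simp add: powr_minus_divide[symmetric])
    ultimately show ?case by (simp add: mult_ac)
  qed
qed (auto intro!: filterlim_ident)

lemma policy_gap: "((\<lambda>t. (M - mu t) * t powr (1 / p)) \<longlongrightarrow> rate powr (- 1 / p)) at_top"
proof (rule Lim_transform_eventually)
  show "((\<lambda>t. ((M - mu t) powr (- p) / t) powr (- 1 / p)) \<longlongrightarrow> rate powr (- 1 / p)) at_top"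
    using rate_pos by (intro tendsto_powr policy_gap_powr tendsto_const) auto
  show "\<forall>\<^sub>F t in at_top. ((M - mu t) powr (- p) / t) powr (- 1 / p) = (M - mu t) * t powr (1 / p)"
    using eventually_gt_at_top[of 0]
  proof eventually_elim
    case (elim t)
    then have "0 < M - mu t" using mu_less by simp
    then show ?case using elim p_pos
      by (simp add: powr_divide powr_mult powr_powr powr_minus_divide)
  qed
qed

lemma policy_gap_power:
  "((\<lambda>t. (M - mu t) powr a * t powr (a / p)) \<longlongrightarrow> rate powr (- a / p)) at_top"
proof (rule Lim_transform_eventually)
  have "((\<lambda>t. ((M - mu t) * t powr (1 / p)) powr a) \<longlongrightarrow> (rate powr (- 1 / p)) powr a) at_top"
    using rate_pos by (intro tendsto_powr policy_gap tendsto_const) auto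
  then show "((\<lambda>t. ((M - mu t) * t powr (1 / p)) powr a) \<longlongrightarrow> rate powr (- a / p)) at_top"
    by (simp add: powr_powr)
  show "\<forall>\<^sub>F t in at_top. ((M - mu t) * t powr (1 / p)) powr a = (M - mu t) powr a * t powr (a / p)"
    using eventually_gt_at_top[of 0]
  proof eventually_elim
    case (elim t)
    then show ?case using mu_less[of t] by (simp add: powr_mult powr_powr)
  qed
qed

lemma policy_expansion:
  "(\<lambda>t. mu t - (M - 1 / rate powr (1 / p) * (1 / t powr (1 / p)))) \<in> o[at_top](\<lambda>t. 1 / t powr (1 / p))"
proof (rule smalloI_tendsto)
  have "((\<lambda>t. rate powr (- 1 / p) - (M - mu t) * t powr (1 / p)) \<longlongrightarrow> rate powr (- 1 / p) - rate powr (- 1 / p)) at_top"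
    by (intro tendsto_intros policy_gap)
  then have lim: "((\<lambda>t. rate powr (- 1 / p) - (M - mu t) * t powr (1 / p)) \<longlongrightarrow> 0) at_top" by simp
  show "((\<lambda>t. (mu t - (M - 1 / rate powr (1 / p) * (1 / t powr (1 / p)))) / (1 / t powr (1 / p))) \<longlongrightarrow> 0) at_top"
  proof (rule Lim_transform_eventually[OF lim])
    show "\<forall>\<^sub>F t in at_top. rate powr (- 1 / p) - (M - mu t) * t powr (1 / p) =
        (mu t - (M - 1 / rate powr (1 / p) * (1 / t powr (1 / p)))) / (1 / t powr (1 / p))"
      using eventually_gt_at_top[of 0]
      by eventually_elim (simp add: field_simps powr_minus_divide)
  qed
  show "\<forall>\<^sub>F t in at_top. 1 / t powr (1 / p) \<noteq> 0"
    using eventually_gt_at_top[of "0::real"] by eventually_elim simp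
qed

lemma excess_policy:
  "((\<lambda>t. excess (mu t) * t powr ((p + 1) / p)) \<longlongrightarrow> c * rate powr (- (p + 1) / p)) at_top"
proof (rule Lim_transform_eventually)
  show "((\<lambda>t. excess (mu t) / (M - mu t) powr (p + 1) * ((M - mu t) powr (p + 1) * t powr ((p + 1) / p)))
      \<longlongrightarrow> c * rate powr (- (p + 1) / p)) at_top"
    by (intro tendsto_mult policy_gap_power filterlim_compose[OF excess_tail mu_at_top])
  show "\<forall>\<^sub>F t in at_top. excess (mu t) / (M - mu t) powr (p + 1) * ((M - mu t) powr (p + 1) * t powr ((p + 1) / p)) =
      excess (mu t) * t powr ((p + 1) / p)"
    using eventually_gt_at_top[of 0]
  proof eventually_elim
    case (elim t)
    then show ?case using mu_less[of t] by simp
  qed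
qed

lemma excess_sq_tail: "((\<lambda>x. excess_sq x / (M - x) powr (p + 2)) \<longlongrightarrow> 2 * c / (p + 2)) (at_left M)"
proof (rule lhopital_left)
  show "(excess_sq \<longlongrightarrow> 0) (at_left M)"
    using isCont_excess_sq[of M] by (simp add: isCont_def excess_sq_upper_end filterlim_at_split)
  show "((\<lambda>x. (M - x) powr (p + 2)) \<longlongrightarrow> 0) (at_left M)" using p_pos by (intro gap_powr_to_0) simp
  show "\<forall>\<^sub>F x in at_left M. (M - x) powr (p + 2) \<noteq> 0"
    using near_upper_end by eventually_elim simp
  show "\<forall>\<^sub>F x in at_left M. - (p + 2) * (M - x) powr (p + 1) \<noteq> 0"
    using near_upper_end by eventually_elim (use p_pos in simp)
  show "\<forall>\<^sub>F x in at_left M. (excess_sq has_real_derivative - 2 * excess x) (at x)"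
    by (intro always_eventually allI excess_sq_has_derivative)
  show "\<forall>\<^sub>F x in at_left M. ((\<lambda>x. (M - x) powr (p + 2)) has_real_derivative - (p + 2) * (M - x) powr (p + 1)) (at x)"
    using near_upper_end
  proof eventually_elim
    case (elim x)
    have e: "p + 2 - 1 = p + 1" by simp
    show ?case using gap_powr_has_derivative[of x "p + 2"] elim by (simp only: e)
  qed
  have "((\<lambda>x. 2 / (p + 2) * (excess x / (M - x) powr (p + 1))) \<longlongrightarrow> 2 / (p + 2) * c) (at_left M)"
    by (intro tendsto_intros excess_tail)
  moreover have "- 2 * excess x / (- (p + 2) * (M - x) powr (p + 1)) = 2 / (p + 2) * (excess x / (M - x) powr (p + 1))" for x
    by (simp only: mult_minus_left minus_divide_divide times_divide_times_eq)
  ultimately show "((\<lambda>x. - 2 * excess x / (- (p + 2) * (M - x) powr (p + 1))) \<longlongrightarrow> 2 * c / (p + 2)) (at_left M)"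
    by simp
qed

lemma ratio_tail:
  "((\<lambda>x. excess_sq x / (excess x)\<^sup>2 * (M - x) powr p) \<longlongrightarrow> 2 / (c * (p + 2))) (at_left M)"
proof (rule Lim_transform_eventually)
  have "((\<lambda>x. excess_sq x / (M - x) powr (p + 2) / (excess x / (M - x) powr (p + 1))\<^sup>2) \<longlongrightarrow> 2 * c / (p + 2) / c\<^sup>2) (at_left M)"
    using c_pos by (intro tendsto_intros excess_sq_tail excess_tail) simp
  moreover have "2 * c / (p + 2) / c\<^sup>2 = 2 / (c * (p + 2))" using c_pos by (simp add: power2_eq_square)
  ultimately show "((\<lambda>x. excess_sq x / (M - x) powr (p + 2) / (excess x / (M - x) powr (p + 1))\<^sup>2) \<longlongrightarrow> 2 / (c * (p + 2))) (at_left M)"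
    by simp
  show "\<forall>\<^sub>F x in at_left M. excess_sq x / (M - x) powr (p + 2) / (excess x / (M - x) powr (p + 1))\<^sup>2 =
      excess_sq x / (excess x)\<^sup>2 * (M - x) powr p"
    using near_upper_end
  proof eventually_elim
    case (elim x)
    then have pos: "0 < M - x" "0 < excess x" by (auto simp: excess_pos)
    have "((M - x) powr (p + 1))\<^sup>2 = (M - x) powr p * (M - x) powr (p + 2)"
      using pos by (simp add: power2_eq_square powr_add[symmetric] algebra_simps)
    then show ?case using pos by (simp add: power_divide)
  qed
qed

lemma ratio_integral_steep:
  assumes "1 < p"
  shows "((\<lambda>x. ratio_integral x * (M - x) powr (p - 1)) \<longlongrightarrow> 2 / (c * (p + 2)) / (p - 1)) (at_left M)"
proof -
  have "((\<lambda>x. ratio_integral x / (M - x) powr (1 - p)) \<longlongrightarrow> 2 / (c * (p + 2)) / (p - 1)) (at_left M)"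
  proof (rule lhopital_left_at_top)
    have "filterlim (\<lambda>x. inverse ((M - x) powr (p - 1))) at_top (at_left M)"
    proof (rule filterlim_inverse_at_top)
      show "((\<lambda>x. (M - x) powr (p - 1)) \<longlongrightarrow> 0) (at_left M)" using assms by (intro gap_powr_to_0) simp
      show "\<forall>\<^sub>F x in at_left M. 0 < (M - x) powr (p - 1)" using near_upper_end by eventually_elim simp
    qed
    then show "filterlim (\<lambda>x. (M - x) powr (1 - p)) at_top (at_left M)"
      by (simp add: powr_minus[symmetric])
    show "\<forall>\<^sub>F x in at_left M. (p - 1) * (M - x) powr (- p) \<noteq> 0"
      using near_upper_end by eventually_elim (use assms in simp)
    show "\<forall>\<^sub>F x in at_left M. (ratio_integral has_real_derivative excess_sq x / (excess x)\<^sup>2) (at x)"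
      using near_upper_end by eventually_elim (simp add: ratio_integral_has_derivative)
    show "\<forall>\<^sub>F x in at_left M. ((\<lambda>x. (M - x) powr (1 - p)) has_real_derivative (p - 1) * (M - x) powr (- p)) (at x)"
      using near_upper_end
    proof eventually_elim
      case (elim x)
      then show ?case using gap_powr_has_derivative[of x "1 - p"] by simp
    qed
    show "((\<lambda>x. excess_sq x / (excess x)\<^sup>2 / ((p - 1) * (M - x) powr (- p))) \<longlongrightarrow> 2 / (c * (p + 2)) / (p - 1)) (at_left M)"
    proof (rule Lim_transform_eventually)
      show "((\<lambda>x. excess_sq x / (excess x)\<^sup>2 * (M - x) powr p / (p - 1)) \<longlongrightarrow> 2 / (c * (p + 2)) / (p - 1)) (at_left M)"
        using assms by (intro tendsto_divide ratio_tail tendsto_const) simp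
      show "\<forall>\<^sub>F x in at_left M. excess_sq x / (excess x)\<^sup>2 * (M - x) powr p / (p - 1) =
          excess_sq x / (excess x)\<^sup>2 / ((p - 1) * (M - x) powr (- p))"
        by (intro always_eventually allI) (simp add: powr_minus_divide)
    qed
  qed
  moreover have "ratio_integral x / (M - x) powr (1 - p) = ratio_integral x * (M - x) powr (p - 1)" for x
  proof -
    have "(M - x) powr (1 - p) = inverse ((M - x) powr (p - 1))" by (simp add: powr_minus[symmetric])
    then show ?thesis by (simp add: divide_inverse)
  qed
  ultimately show ?thesis by simp
qed

lemma ratio_integral_critical:
  assumes "p = 1"
  shows "((\<lambda>x. ratio_integral x / - ln (M - x)) \<longlongrightarrow> 2 / (3 * c)) (at_left M)"
proof (rule lhopital_left_at_top)
  show "filterlim (\<lambda>x. - ln (M - x)) at_top (at_left M)" by (rule neg_ln_gap_at_top)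
  show "\<forall>\<^sub>F x in at_left M. 1 / (M - x) \<noteq> 0"
    using near_upper_end by eventually_elim simp
  show "\<forall>\<^sub>F x in at_left M. (ratio_integral has_real_derivative excess_sq x / (excess x)\<^sup>2) (at x)"
    using near_upper_end by eventually_elim (simp add: ratio_integral_has_derivative)
  show "\<forall>\<^sub>F x in at_left M. ((\<lambda>x. - ln (M - x)) has_real_derivative 1 / (M - x)) (at x)"
    using near_upper_end by eventually_elim (auto intro!: derivative_eq_intros)
  show "((\<lambda>x. excess_sq x / (excess x)\<^sup>2 / (1 / (M - x))) \<longlongrightarrow> 2 / (3 * c)) (at_left M)"
  proof (rule Lim_transform_eventually)
    show "((\<lambda>x. excess_sq x / (excess x)\<^sup>2 * (M - x) powr p) \<longlongrightarrow> 2 / (3 * c)) (at_left M)"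
      using ratio_tail assms by (simp add: mult.commute)
    show "\<forall>\<^sub>F x in at_left M. excess_sq x / (excess x)\<^sup>2 * (M - x) powr p = excess_sq x / (excess x)\<^sup>2 / (1 / (M - x))"
      using near_upper_end by eventually_elim (simp add: assms)
  qed
qed

lemma ratio_integral_mono:
  assumes "m0 \<le> x" "x \<le> y" "y < M" shows "ratio_integral x \<le> ratio_integral y"
  by (rule increasing_on_Ico[OF continuous_on_ratio_integral ratio_integral_has_derivative _ assms])
    (simp_all add: excess_sq_nonneg)

text \<open>
  Near \<open>M\<close> the integrand is at most a multiple of \<open>(M - x) powr (- p)\<close>, which has a bounded primitive when \<open>p < 1\<close>.
\<close>

lemma ratio_integral_bounded:
  assumes "p < 1"
  obtains B where "\<And>x. m0 \<le> x \<Longrightarrow> x < M \<Longrightarrow> ratio_integral x \<le> B"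
proof -
  define b where "b = 2 / (c * (p + 2)) + 1"
  have "\<forall>\<^sub>F x in at_left M. excess_sq x / (excess x)\<^sup>2 * (M - x) powr p < b"
    by (rule order_tendstoD(2)[OF ratio_tail]) (simp add: b_def)
  then have "\<forall>\<^sub>F x in at_left M. m0 < x \<and> excess_sq x / (excess x)\<^sup>2 * (M - x) powr p < b"
    using near_upper_end by eventually_elim simp
  then obtain a' where a': "a' < M"
    "\<And>x. a' < x \<Longrightarrow> x < M \<Longrightarrow> m0 < x \<and> excess_sq x / (excess x)\<^sup>2 * (M - x) powr p < b"
    by (auto simp: eventually_at_left_field)
  define a where "a = max m0 a'"
  have a: "m0 \<le> a" "a < M" using a' m0_less by (auto simp: a_def)
  have near: "ratio_integral x \<le> ratio_integral a + b * (M - a) powr (1 - p) / (1 - p)" if x: "a \<le> x" "x < M" for x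
  proof -
    have "- ratio_integral a - b * (M - a) powr (1 - p) / (1 - p) \<le> - ratio_integral x - b * (M - x) powr (1 - p) / (1 - p)"
    proof (rule increasing_on_Ico[where a=a and b=M and f="\<lambda>x. - ratio_integral x - b * (M - x) powr (1 - p) / (1 - p)"])
      show "continuous_on {a..<M} (\<lambda>x. - ratio_integral x - b * (M - x) powr (1 - p) / (1 - p))"
        using a assms by (intro continuous_intros continuous_on_subset[OF continuous_on_ratio_integral]) auto
      fix y assume y: "a < y" "y < M"
      then have "m0 < y" "a' < y" using a by (auto simp: a_def)
      from gap_powr_has_derivative[OF y(2), of "1 - p"]
      have d: "((\<lambda>x. (M - x) powr (1 - p)) has_real_derivative - (1 - p) * (M - y) powr (- p)) (at y)" by simp
      have "((\<lambda>x. - ratio_integral x - b * (M - x) powr (1 - p) / (1 - p)) has_real_derivative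
          - (excess_sq y / (excess y)\<^sup>2) - b * (- (1 - p) * (M - y) powr (- p)) / (1 - p)) (at y)"
        by (rule DERIV_diff[OF DERIV_minus[OF ratio_integral_has_derivative[OF \<open>m0 < y\<close> y(2)]]
              DERIV_cdivide[OF DERIV_cmult[OF d]]])
      moreover have "- (excess_sq y / (excess y)\<^sup>2) - b * (- (1 - p) * (M - y) powr (- p)) / (1 - p) =
          b * (M - y) powr (- p) - excess_sq y / (excess y)\<^sup>2"
        using assms by (simp add: field_simps)
      ultimately show "((\<lambda>x. - ratio_integral x - b * (M - x) powr (1 - p) / (1 - p)) has_real_derivative
          b * (M - y) powr (- p) - excess_sq y / (excess y)\<^sup>2) (at y)" by (simp only:)
      have "excess_sq y / (excess y)\<^sup>2 * (M - y) powr p \<le> b" using a'(2)[OF \<open>a' < y\<close> y(2)] by simp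
      then show "0 \<le> b * (M - y) powr (- p) - excess_sq y / (excess y)\<^sup>2"
        using y by (simp add: powr_minus_divide field_simps)
    qed (use x in auto)
    moreover have "0 \<le> b * (M - x) powr (1 - p) / (1 - p)"
      using assms c_pos p_pos by (auto simp: b_def)
    ultimately show ?thesis by linarith
  qed
  show thesis
  proof (rule that)
    fix x assume x: "m0 \<le> x" "x < M"
    then have "ratio_integral x \<le> ratio_integral (max x a)" using a by (intro ratio_integral_mono) auto
    also have "\<dots> \<le> ratio_integral a + b * (M - a) powr (1 - p) / (1 - p)" using x a by (intro near) auto
    finally show "ratio_integral x \<le> ratio_integral a + b * (M - a) powr (1 - p) / (1 - p)" .
  qed
qed

lemma ratio_integral_converges:
  assumes "p < 1"
  obtains I where "(ratio_integral \<longlongrightarrow> I) (at_left M)"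
proof -
  obtain B where B: "\<And>x. m0 \<le> x \<Longrightarrow> x < M \<Longrightarrow> ratio_integral x \<le> B"
    using ratio_integral_bounded[OF assms] by blast
  have bdd: "bdd_above (ratio_integral ` {m0..<M})" using B by (auto intro!: bdd_aboveI2)
  have ne: "{m0..<M} \<noteq> {}" using m0_less by simp
  show thesis
  proof (rule that, rule order_tendstoI)
    fix y assume "y < (SUP x\<in>{m0..<M}. ratio_integral x)"
    then obtain x0 where x0: "m0 \<le> x0" "x0 < M" "y < ratio_integral x0"
      using less_cSUP_iff[OF ne bdd] by auto
    show "\<forall>\<^sub>F x in at_left M. y < ratio_integral x"
      using eventually_at_left_real[OF x0(2)]
      by eventually_elim (use x0 ratio_integral_mono in \<open>fastforce intro: less_le_trans\<close>)
  next
    fix y assume y: "(SUP x\<in>{m0..<M}. ratio_integral x) < y"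
    show "\<forall>\<^sub>F x in at_left M. ratio_integral x < y"
      using near_upper_end
    proof eventually_elim
      case (elim x)
      then have "ratio_integral x \<le> (SUP x\<in>{m0..<M}. ratio_integral x)" using bdd by (intro cSUP_upper) auto
      with y show ?case by simp
    qed
  qed
qed

text \<open>
  The squared coefficient of variation of \<open>(X - w)\<^sub>+\<close> is \<open>excess_sq w / (excess w)\<^sup>2 - 1\<close>, so \<open>ratio_integral x - (x - m0)\<close>
  is a primitive. As the integrand is nonnegative, convergence of the primitive gives integrability.
\<close>

lemma squared_variation_integral:
  assumes I: "(ratio_integral \<longlongrightarrow> I) (at_left M)"
  defines "f \<equiv> \<lambda>w. variance (\<lambda>x. max (x - w) 0) / (expectation (\<lambda>x. max (x - w) 0))\<^sup>2"
  shows "set_integrable lborel {m0..<M} f" and "(LBINT w:{m0..<M}. f w) = I - (M - m0)"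
proof -
  have f_eq: "f w = (excess_sq w - (excess w)\<^sup>2) / (excess w)\<^sup>2" for w
    unfolding f_def variance_excess by (simp add: excess_def)
  have f_ratio: "f w = excess_sq w / (excess w)\<^sup>2 - 1" if "w < M" for w
    using excess_pos[OF that] by (simp add: f_eq diff_divide_distrib)
  have f_nonneg: "0 \<le> f w" for w by (simp add: f_def)
  have f_cont: "isCont f w" if "w < M" for w
  proof -
    have "f = (\<lambda>w. (excess_sq w - (excess w)\<^sup>2) / (excess w)\<^sup>2)" using f_eq by (simp add: fun_eq_iff)
    then show ?thesis using excess_pos[OF that]
      by (simp only:) (intro isCont_divide isCont_diff isCont_power isCont_excess isCont_excess_sq, simp)
  qed
  have f_meas: "(\<lambda>w. indicator S w *\<^sub>R f w) \<in> borel_measurable borel" if "S \<in> sets borel" "S \<subseteq> {..<M}" for S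
    using that f_cont by (intro borel_measurable_continuous_on_indicator continuous_at_imp_continuous_on) auto
  let ?F = "\<lambda>x. ratio_integral x - (x - m0)"
  have F: "((?F \<circ> real_of_ereal) \<longlongrightarrow> 0) (at_right (ereal m0))"
  proof -
    have "(ratio_integral \<longlongrightarrow> 0) (at_right m0)"
    proof -
      have "continuous_on {m0..(m0 + M) / 2} ratio_integral"
        using m0_less by (intro continuous_on_subset[OF continuous_on_ratio_integral]) auto
      from continuous_on_Icc_at_rightD[OF this] show ?thesis using m0_less by (simp add: ratio_integral_m0)
    qed
    then have "(?F \<longlongrightarrow> 0 - (m0 - m0)) (at_right m0)" by (intro tendsto_intros)
    then show ?thesis by (simp add: ereal_tendsto_simps1)
  qed
  have G: "((?F \<circ> real_of_ereal) \<longlongrightarrow> I - (M - m0)) (at_left (ereal M))"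
    unfolding ereal_tendsto_simps1 by (intro tendsto_intros I)
  have der: "(?F has_real_derivative f x) (at x)" if "m0 < x" "x < M" for x
    unfolding f_ratio[OF that(2)]
    by (rule derivative_eq_intros ratio_integral_has_derivative[OF that] refl)+ simp
  have F_der: "(?F has_real_derivative f x) (at x)" if "ereal m0 < ereal x" "ereal x < ereal M" for x
    using der[of x] that by simp
  have f_cont': "isCont f x" if "ereal m0 < ereal x" "ereal x < ereal M" for x
    using f_cont[of x] that by simp
  have f_nonneg': "AE x in lborel. ereal m0 < ereal x \<longrightarrow> ereal x < ereal M \<longrightarrow> 0 \<le> f x"
    using f_nonneg by (intro always_eventually) blast
  have "ereal m0 < ereal M" using m0_less by simp
  note ftc = interval_integral_FTC_nonneg[OF this F_der f_cont' f_nonneg' F G]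
  have int: "set_integrable lborel {m0<..<M} f" using ftc(1) by (simp only: einterval_eq)
  have val: "(LBINT x=ereal m0..ereal M. f x) = I - (M - m0)" using ftc(2) by (simp only: diff_zero)
  have ae: "AE w in lborel. indicator {m0<..<M} w *\<^sub>R f w = indicator {m0..<M} w *\<^sub>R f w"
    using AE_lborel_singleton[of m0] by eventually_elim (auto simp: indicator_def)
  have meas: "(\<lambda>w. indicator {m0<..<M} w *\<^sub>R f w) \<in> borel_measurable lborel"
    "(\<lambda>w. indicator {m0..<M} w *\<^sub>R f w) \<in> borel_measurable lborel"
    using f_meas[of "{m0<..<M}"] f_meas[of "{m0..<M}"] unfolding measurable_lborel1 by force+
  show "set_integrable lborel {m0..<M} f"
    using int integrable_cong_AE[OF meas ae] unfolding set_integrable_def by blast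
  have "(LBINT w:{m0..<M}. f w) = (LBINT w:{m0<..<M}. f w)"
    unfolding set_lebesgue_integral_def by (rule integral_cong_AE[OF meas ae, symmetric])
  also have "\<dots> = (LBINT x=ereal m0..ereal M. f x)"
    unfolding interval_lebesgue_integral_def einterval_eq using m0_less by (simp only: ereal_less_eq less_imp_le if_True)
  finally show "(LBINT w:{m0..<M}. f w) = I - (M - m0)" unfolding val .
qed

text \<open>
  The weight \<open>w\<close> compensates the growth of \<open>ratio_integral\<close> at \<open>M\<close>; the three regimes use \<open>w = 1\<close>, \<open>w = 1 / - ln (M - x)\<close>
  and \<open>w = (M - x) powr (p - 1)\<close>.
\<close>

lemma price_variance_scaled:
  assumes "((\<lambda>x. (V0 / excess m0 + ratio_integral x) * w x) \<longlongrightarrow> B) (at_left M)"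
  shows "((\<lambda>t. price_variance V0 t * w (mu t) * t powr ((p + 1) / p)) \<longlongrightarrow> c * rate powr (- (p + 1) / p) * B) at_top"
proof -
  have "((\<lambda>t. (excess (mu t) * t powr ((p + 1) / p)) * ((V0 / excess m0 + ratio_integral (mu t)) * w (mu t)))
      \<longlongrightarrow> c * rate powr (- (p + 1) / p) * B) at_top"
    by (intro tendsto_mult excess_policy filterlim_compose[OF assms mu_at_top])
  then show ?thesis by (simp add: price_variance_def mult_ac)
qed

lemma price_variance_flat:
  assumes "(ratio_integral \<longlongrightarrow> I) (at_left M)" and pos: "0 < V0 / excess m0 + I"
  shows "price_variance V0 \<sim>[at_top] (\<lambda>t. 1 / ((lam * p) powr ((p + 1) / p) * c powr (1 / p)) *
    (V0 / excess m0 + I) * (1 / t powr ((p + 1) / p)))"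
proof (rule asymp_equivI')
  define L where "L = 1 / ((lam * p) powr ((p + 1) / p) * c powr (1 / p))"
  have L: "0 < L" using lam_pos p_pos c_pos by (simp add: L_def)
  have rate_L: "c * rate powr (- (p + 1) / p) = L"
  proof -
    have "rate powr (- (p + 1) / p) = 1 / rate powr ((p + 1) / p)"
      by (metis minus_divide_left powr_minus_divide)
    also have "rate powr ((p + 1) / p) = (lam * p) powr ((p + 1) / p) * (c powr (1 / p) * c)"
    proof -
      have "(p + 1) / p = 1 / p + 1" using p_pos by (simp add: field_simps)
      then have "c powr ((p + 1) / p) = c powr (1 / p) * c" using c_pos by (simp add: powr_add)
      then show ?thesis using lam_pos p_pos c_pos by (simp add: rate_def powr_mult)
    qed
    finally show ?thesis using c_pos by (simp add: L_def)
  qed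
  have "((\<lambda>x. (V0 / excess m0 + ratio_integral x) * 1) \<longlongrightarrow> (V0 / excess m0 + I) * 1) (at_left M)"
    by (intro tendsto_intros assms)
  from price_variance_scaled[OF this]
  have "((\<lambda>t. price_variance V0 t * t powr ((p + 1) / p)) \<longlongrightarrow> L * (V0 / excess m0 + I)) at_top"
    by (simp only: rate_L mult_1_right)
  then have "((\<lambda>t. price_variance V0 t * t powr ((p + 1) / p) / (L * (V0 / excess m0 + I))) \<longlongrightarrow>
      L * (V0 / excess m0 + I) / (L * (V0 / excess m0 + I))) at_top"
    using L pos by (intro tendsto_divide tendsto_const) auto
  then have lim: "((\<lambda>t. price_variance V0 t * t powr ((p + 1) / p) / (L * (V0 / excess m0 + I))) \<longlongrightarrow> 1) at_top"
    using L pos by simp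
  have "a * y / (L * (V0 / excess m0 + I)) = a / (L * (V0 / excess m0 + I) * (1 / y))" for a y by simp
  with lim show "((\<lambda>t. price_variance V0 t / (1 / ((lam * p) powr ((p + 1) / p) * c powr (1 / p)) *
    (V0 / excess m0 + I) * (1 / t powr ((p + 1) / p)))) \<longlongrightarrow> 1) at_top"
    unfolding L_def[symmetric] by (simp only:)
qed

lemma price_variance_critical:
  assumes "p = 1"
  shows "price_variance V0 \<sim>[at_top] (\<lambda>t. 2 / (3 * lam\<^sup>2 * c\<^sup>2) * (ln t / t\<^sup>2))"
proof (rule asymp_equivI')
  define K where "K = 2 / (3 * lam\<^sup>2 * c\<^sup>2)"
  have K: "0 < K" using lam_pos c_pos by (simp add: K_def)
  have "((\<lambda>x. (V0 / excess m0) / - ln (M - x) + ratio_integral x / - ln (M - x)) \<longlongrightarrow> 0 + 2 / (3 * c)) (at_left M)"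
    by (intro tendsto_add ratio_integral_critical[OF assms] real_tendsto_divide_at_top[OF tendsto_const neg_ln_gap_at_top])
  then have "((\<lambda>x. (V0 / excess m0 + ratio_integral x) * (1 / - ln (M - x))) \<longlongrightarrow> 2 / (3 * c)) (at_left M)"
    by (simp add: add_divide_distrib diff_divide_distrib)
  from price_variance_scaled[OF this]
  have scaled: "((\<lambda>t. price_variance V0 t * (1 / - ln (M - mu t)) * t powr 2) \<longlongrightarrow> c * rate powr (- 2) * (2 / (3 * c))) at_top"
    using assms by simp
  have const: "c * rate powr (- 2) * (2 / (3 * c)) = K"
  proof -
    have "rate powr (- 2) = 1 / rate\<^sup>2" using rate_pos by (simp add: powr_minus_divide)
    moreover have "rate = lam * c" unfolding rate_def using assms by simp
    ultimately show ?thesis using c_pos by (simp add: K_def power_mult_distrib power2_eq_square)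
  qed
  \<comment> \<open>The product of \<open>M - mu t\<close> and \<open>t\<close> converges to a positive number, so \<open>- ln (M - mu t)\<close> and \<open>ln t\<close> differ by a bounded amount.\<close>
  have log_ratio: "((\<lambda>t. - ln (M - mu t) / ln t) \<longlongrightarrow> 1) at_top"
  proof (rule Lim_transform_eventually)
    have "((\<lambda>t. ln ((M - mu t) * t powr (1 / p))) \<longlongrightarrow> ln (rate powr (- 1 / p))) at_top"
      using rate_pos by (intro tendsto_ln policy_gap) simp
    from tendsto_diff[OF tendsto_const real_tendsto_divide_at_top[OF this ln_at_top]]
    show "((\<lambda>t. 1 - ln ((M - mu t) * t powr (1 / p)) / ln t) \<longlongrightarrow> 1) at_top" by (metis diff_zero)
    show "\<forall>\<^sub>F t in at_top. 1 - ln ((M - mu t) * t powr (1 / p)) / ln t = - ln (M - mu t) / ln t"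
      using eventually_gt_at_top[of 1]
    proof eventually_elim
      case (elim t)
      then have "0 < M - mu t" "0 < ln t" using mu_less[of t] by auto
      then show ?case using elim assms by (simp add: ln_mult add_divide_distrib)
    qed
  qed
  have "((\<lambda>t. price_variance V0 t * (1 / - ln (M - mu t)) * t powr 2 * (- ln (M - mu t) / ln t) / K) \<longlongrightarrow> K * 1 / K) at_top"
    using scaled K unfolding const by (intro tendsto_divide tendsto_mult log_ratio tendsto_const) auto
  then have "((\<lambda>t. price_variance V0 t * (1 / - ln (M - mu t)) * t powr 2 * (- ln (M - mu t) / ln t) / K) \<longlongrightarrow> 1) at_top"
    using K by simp
  then show "((\<lambda>t. price_variance V0 t / (2 / (3 * lam\<^sup>2 * c\<^sup>2) * (ln t / t\<^sup>2))) \<longlongrightarrow> 1) at_top"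
  proof (rule Lim_transform_eventually)
    have "\<forall>\<^sub>F t in at_top. 0 < - ln (M - mu t)"
      using filterlim_compose[OF neg_ln_gap_at_top mu_at_top] unfolding filterlim_at_top_dense by blast
    then show "\<forall>\<^sub>F t in at_top. price_variance V0 t * (1 / - ln (M - mu t)) * t powr 2 * (- ln (M - mu t) / ln t) / K =
        price_variance V0 t / (2 / (3 * lam\<^sup>2 * c\<^sup>2) * (ln t / t\<^sup>2))"
      using eventually_gt_at_top[of 1]
    proof eventually_elim
      case (elim t)
      have "a * (1 / l) * u * (l / n) / K = a / (K * (n / u))" if "l \<noteq> 0" for a l u n
        using that by simp
      moreover have "t powr 2 = t\<^sup>2" using elim by simp
      ultimately show ?case using elim unfolding K_def[symmetric] by (metis less_irrefl)
    qed
  qed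
qed

lemma price_variance_steep:
  assumes "1 < p"
  shows "price_variance V0 \<sim>[at_top]
    (\<lambda>t. 2 / (p - 1) * (1 / (p + 2)) * (1 / rate powr (2 / p)) * (1 / t powr (2 / p)))"
proof (rule asymp_equivI')
  define K where "K = 2 / (p - 1) * (1 / (p + 2)) * (1 / rate powr (2 / p))"
  have K: "0 < K" using assms rate_pos by (simp add: K_def)
  define A where "A = 2 / (c * (p + 2)) / (p - 1)"
  have "((\<lambda>x. V0 / excess m0 * (M - x) powr (p - 1) + ratio_integral x * (M - x) powr (p - 1)) \<longlongrightarrow> V0 / excess m0 * 0 + A) (at_left M)"
    unfolding A_def using assms by (intro tendsto_add tendsto_mult tendsto_const ratio_integral_steep gap_powr_to_0) simp
  then have "((\<lambda>x. (V0 / excess m0 + ratio_integral x) * (M - x) powr (p - 1)) \<longlongrightarrow> A) (at_left M)"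
    by (simp add: algebra_simps)
  from price_variance_scaled[OF this]
  have "((\<lambda>t. price_variance V0 t * (M - mu t) powr (p - 1) * t powr ((p + 1) / p) /
      ((M - mu t) powr (p - 1) * t powr ((p - 1) / p)) / K) \<longlongrightarrow>
      c * rate powr (- (p + 1) / p) * A / rate powr (- (p - 1) / p) / K) at_top"
    using rate_pos K by (intro tendsto_divide policy_gap_power tendsto_const) auto
  moreover have "c * rate powr (- (p + 1) / p) * A / rate powr (- (p - 1) / p) = K"
  proof -
    have "rate powr (- (p + 1) / p) / rate powr (- (p - 1) / p) = rate powr (- (2 / p))"
      by (simp add: powr_diff[symmetric] diff_divide_distrib[symmetric])
    then have "c * rate powr (- (p + 1) / p) * A / rate powr (- (p - 1) / p) = c * A * rate powr (- (2 / p))"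
      by (simp only: times_divide_eq_right[symmetric] mult_ac)
    then show ?thesis using c_pos by (simp add: K_def A_def powr_minus_divide)
  qed
  ultimately have "((\<lambda>t. price_variance V0 t * (M - mu t) powr (p - 1) * t powr ((p + 1) / p) /
      ((M - mu t) powr (p - 1) * t powr ((p - 1) / p)) / K) \<longlongrightarrow> K / K) at_top" by (simp only:)
  moreover have "K / K = 1" using K by simp
  ultimately have "((\<lambda>t. price_variance V0 t * (M - mu t) powr (p - 1) * t powr ((p + 1) / p) /
      ((M - mu t) powr (p - 1) * t powr ((p - 1) / p)) / K) \<longlongrightarrow> 1) at_top" by (simp only:)
  then show "((\<lambda>t. price_variance V0 t / (2 / (p - 1) * (1 / (p + 2)) * (1 / rate powr (2 / p)) * (1 / t powr (2 / p)))) \<longlongrightarrow> 1) at_top"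
  proof (rule Lim_transform_eventually)
    show "\<forall>\<^sub>F t in at_top. price_variance V0 t * (M - mu t) powr (p - 1) * t powr ((p + 1) / p) /
      ((M - mu t) powr (p - 1) * t powr ((p - 1) / p)) / K =
      price_variance V0 t / (2 / (p - 1) * (1 / (p + 2)) * (1 / rate powr (2 / p)) * (1 / t powr (2 / p)))"
      using eventually_gt_at_top[of 0]
    proof eventually_elim
      case (elim t)
      then have "M - mu t \<noteq> 0" using mu_less[of t] by simp
      moreover have "t powr ((p + 1) / p) = t powr (2 / p) * t powr ((p - 1) / p)"
      proof -
        have "(p + 1) / p = 2 / p + (p - 1) / p" by (simp add: add_divide_distrib[symmetric])
        then show ?thesis by (simp only: powr_add)
      qed
      moreover have "a * g * (u * w) / (g * w) / K = a / (K * (1 / u))" if "g \<noteq> 0" "w \<noteq> 0" for a g u w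
        using that by simp
      ultimately show ?case using elim by (simp only: K_def[symmetric]) simp
    qed
  qed
qed

end

section \<open>Expansion of the policy and variance of the sale price\<close>

theorem theorem5p1:
  fixes P :: "'a measure" and N N0 :: "real measure"
    and D X :: "nat \<Rightarrow> 'a \<Rightarrow> real"
    and lam m0 M p c :: real and \<mu> :: "real \<Rightarrow> real" and V :: "real \<Rightarrow> real"
  assumes lam: "0 < lam"
    and N: "real_distribution N"
    and N0: "real_distribution N0"
    and process: "bidding_process P lam N N0 D X"
    and int_offer: "integrable N (\<lambda>x. max x 0)"
    and int_residual: "integrable N0 (\<lambda>x. \<bar>x\<bar>)"
    and m0: "m0 = prob_space.expectation N0 (\<lambda>x. x)"
    and M: "upper_end N = ereal M"
    and m0_bounds: "0 \<le> m0" "m0 < M"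
    and p: "0 < p" and c: "0 < c"
    and phi_limit: "((\<lambda>x. phi N x / (M - x) powr (p + 1)) \<longlongrightarrow> c) (at_left M)"
    and \<mu>: "\<mu> = opt_policy lam N m0"
    and V: "V = (\<lambda>t. prob_space.variance P
                   (\<lambda>\<omega>. sale_price \<mu> t (\<lambda>i. D i \<omega>) (\<lambda>i. X i \<omega>)))"
  shows
    "(\<lambda>t. \<mu> t - (M - 1 / (lam * p * c) powr (1 / p) * (1 / t powr (1 / p))))
        \<in> o[at_top](\<lambda>t. 1 / t powr (1 / p))
     \<and> (integrable N0 (\<lambda>x. x\<^sup>2) \<longrightarrow>
         (p < 1 \<longrightarrow>
            set_integrable lborel {m0..<M}
              (\<lambda>w. prob_space.variance N (\<lambda>x. max (x - w) 0)
                   / (prob_space.expectation N (\<lambda>x. max (x - w) 0))\<^sup>2)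
            \<and> V \<sim>[at_top]
              (\<lambda>t. 1 / ((lam * p) powr ((p + 1) / p) * c powr (1 / p))
                   * ((M - m0)
                      + prob_space.variance N0 (\<lambda>x. x) / phi N m0
                      + (LBINT w:{m0..<M}.
                           prob_space.variance N (\<lambda>x. max (x - w) 0)
                           / (prob_space.expectation N (\<lambda>x. max (x - w) 0))\<^sup>2))
                   * (1 / t powr ((p + 1) / p))))
       \<and> (p = 1 \<longrightarrow>
            V \<sim>[at_top] (\<lambda>t. 2 / (3 * lam\<^sup>2 * c\<^sup>2) * (ln t / t\<^sup>2)))
       \<and> (1 < p \<longrightarrow>
            V \<sim>[at_top]
              (\<lambda>t. 2 / (p - 1) * (1 / (p + 2)) * (1 / (lam * p * c) powr (2 / p))
                   * (1 / t powr (2 / p)))))"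
proof -
  interpret sale: bidding_process P lam N N0 D X by (rule process)
  interpret offers: power_tail N M lam m0 p c
  proof -
    interpret N: real_distribution N by (rule N)
    interpret N: bounded_offers N M by unfold_locales (rule M)
    show "power_tail N M lam m0 p c"
      using phi_limit by unfold_locales (simp_all add: lam m0_bounds p c N.phi_eq_excess)
  qed
  interpret N0: real_distribution N0 by (rule N0)
  have "integrable N0 (\<lambda>x. x)"
    using int_residual by (subst integrable_abs_iff[symmetric]) simp_all
  then interpret sale: optimal_sale N M lam m0 P N0 D X
    by unfold_locales (simp_all add: m0)
  have mu_eq: "\<mu> = offers.mu" unfolding \<mu> offers.mu_def ..
  define V0 where "V0 = N0.variance (\<lambda>x. x)"
  have V_eq: "V t = offers.price_variance V0 t" if "0 \<le> t" "integrable N0 (\<lambda>x. x\<^sup>2)" for t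
    using sale.variance_sale_price[OF that] by (simp add: V mu_eq sale.sale_def[abs_def] V0_def)
  have V_equiv: "V \<sim>[at_top] g" if "offers.price_variance V0 \<sim>[at_top] g" "integrable N0 (\<lambda>x. x\<^sup>2)" for g
  proof (rule asymp_equiv_transfer[OF that(1)])
    show "\<forall>\<^sub>F t in at_top. offers.price_variance V0 t = V t"
      using eventually_ge_at_top[of "0::real"] by eventually_elim (simp add: V_eq that)
  qed simp
  show ?thesis
  proof (intro conjI impI)
    show "(\<lambda>t. \<mu> t - (M - 1 / (lam * p * c) powr (1 / p) * (1 / t powr (1 / p)))) \<in> o[at_top](\<lambda>t. 1 / t powr (1 / p))"
      using offers.policy_expansion unfolding mu_eq offers.rate_def .
  next
    assume "p < 1"
    then obtain I where I: "(offers.ratio_integral \<longlongrightarrow> I) (at_left M)"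
      using offers.ratio_integral_converges by blast
    show "set_integrable lborel {m0..<M}
        (\<lambda>w. offers.variance (\<lambda>x. max (x - w) 0) / (offers.expectation (\<lambda>x. max (x - w) 0))\<^sup>2)"
      by (rule offers.squared_variation_integral(1)[OF I])
  next
    assume sq: "integrable N0 (\<lambda>x. x\<^sup>2)" and "p < 1"
    then obtain I where I: "(offers.ratio_integral \<longlongrightarrow> I) (at_left M)"
      using offers.ratio_integral_converges by blast
    let ?J = "LBINT w:{m0..<M}. offers.variance (\<lambda>x. max (x - w) 0) / (offers.expectation (\<lambda>x. max (x - w) 0))\<^sup>2"
    have J: "?J = I - (M - m0)" by (rule offers.squared_variation_integral(2)[OF I])
    have "0 \<le> ?J" unfolding set_lebesgue_integral_def by (intro Bochner_Integration.integral_nonneg) auto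
    moreover have "0 \<le> V0 / offers.excess m0"
      using offers.excess_pos[OF m0_bounds(2)] by (simp add: V0_def)
    ultimately have "0 < V0 / offers.excess m0 + I" using J m0_bounds by simp
    note equiv = offers.price_variance_flat[OF I this]
    have "V0 / offers.excess m0 + I = (M - m0) + V0 / phi N m0 + ?J"
      unfolding J offers.phi_eq_excess by simp
    with V_equiv[OF equiv sq] show "V \<sim>[at_top]
        (\<lambda>t. 1 / ((lam * p) powr ((p + 1) / p) * c powr (1 / p)) *
          ((M - m0) + N0.variance (\<lambda>x. x) / phi N m0 + ?J) * (1 / t powr ((p + 1) / p)))"
      by (simp only: V0_def)
  next
    assume "integrable N0 (\<lambda>x. x\<^sup>2)" "p = 1"
    then show "V \<sim>[at_top] (\<lambda>t. 2 / (3 * lam\<^sup>2 * c\<^sup>2) * (ln t / t\<^sup>2))"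
      by (intro V_equiv offers.price_variance_critical)
  next
    assume "integrable N0 (\<lambda>x. x\<^sup>2)" "1 < p"
    then show "V \<sim>[at_top] (\<lambda>t. 2 / (p - 1) * (1 / (p + 2)) * (1 / (lam * p * c) powr (2 / p)) * (1 / t powr (2 / p)))"
      using V_equiv[OF offers.price_variance_steep] unfolding offers.rate_def by blast
  qed
qed

end
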